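(* Let $G$ and $H$ be regular graphs with vertex degrees $d_G$ and $d_H$, respectively, and put $d_{G\boxtimes H}=d_G+d_H+d_Gd_H$ (the vertex degree of $G\boxtimes H$). Let $x_1,x_2\in V(G)$ satisfy $N_G[x_1]=N_G[x_2]$, and let $y_1,y_2$ be adjacent vertices of $H$. Then, in $G\boxtimes H$, \[ \kappa_{\mathrm{LLY}}((x_1,y_1),(x_2,y_2))=\frac{d_H(d_G+1)}{d_{G\boxtimes H}}\,\kappa_{\mathrm{LLY}}(y_1,y_2), \] \[ \kappa_0((x_1,y_1),(x_2,y_2))=\frac{d_Gd_H}{d_{G\boxtimes H}}\,\kappa_{\mathrm{LLY}}(y_1,y_2)+\frac{d_H}{d_{G\boxtimes H}}\,\kappa_0(y_1,y_2), \] where curvatures on the left are computed in $G\boxtimes H$ and those on the right in $H$.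
   Context: Graphs are simple, undirected and locally finite; $d(\cdot,\cdot)$ is the shortest-path distance, $N(x)$ the set of neighbours of $x$ and $N[x]=N(x)\cup\{x\}$. For $x\in V$ and $\alpha\in[0,1]$, the probability measure $\mu_x^\alpha$ on $V$ is $\mu_x^\alpha(x)=\alpha$, $\mu_x^\alpha(y)=(1-\alpha)/d_x$ for $y\in N(x)$, and $0$ otherwise. The Wasserstein distance between probability measures $\mu_1,\mu_2$ on $V$ is $W(\mu_1,\mu_2)=\inf_\pi\sum_{x,y\in V}d(x,y)\pi(x,y)$, the infimum over all $\pi:V\times V\to[0,1]$ with $\sum_y\pi(x,y)=\mu_1(x)$ and $\sum_x\pi(x,y)=\mu_2(y)$. For distinct $x,y$, the $\alpha$-Ricci (Ollivier) curvature is $\kappa_\alpha(x,y)=1-W(\mu_x^\alpha,\mu_y^\alpha)/d(x,y)$; $\kappa_0$ is the case $\alpha=0$, and the Lin--Lu--Yau curvature is $\kappa_{\mathrm{LLY}}(x,y)=\lim_{\alpha\to1}\kappa_\alpha(x,y)/(1-\alpha)$. The strong product $G\boxtimes H$ has vertex set $V(G)\times V(H)$, with distinct $(x_1,y_1),(x_2,y_2)$ adjacent iff $x_2\in N_G[x_1]$ and $y_2\in N_H[y_1]$. *)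

theory Defs
  imports
    "HOL-Analysis.Analysis"
    "Graph_Theory.Pair_Digraph"
    "Graph_Theory.Shortest_Path"
begin

text \<open>
  An undirected graph is a loop-free digraph with a symmetric arc relation; the vertex set
  may be infinite and the graph need not be connected.
\<close>

definition neighbors :: "'a pair_pre_digraph \<Rightarrow> 'a \<Rightarrow> 'a set" where
  "neighbors G x = {y. (x, y) \<in> parcs G}"

definition closed_neighbors :: "'a pair_pre_digraph \<Rightarrow> 'a \<Rightarrow> 'a set" where
  "closed_neighbors G x = insert x (neighbors G x)"

locale locally_finite_graph = pair_bidirected_digraph +
  assumes locally_finite: "x \<in> pverts G \<Longrightarrow> finite (neighbors G x)"

definition regular_graph :: "'a pair_pre_digraph \<Rightarrow> nat \<Rightarrow> bool" where
  "regular_graph G d \<longleftrightarrow> (\<forall>x \<in> pverts G. card (neighbors G x) = d)"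

text \<open>
  The infimum of the lengths of all walks, hence \<open>\<infinity>\<close> between different components.
\<close>

definition graph_dist :: "'a pair_pre_digraph \<Rightarrow> 'a \<Rightarrow> 'a \<Rightarrow> ereal" where
  "graph_dist G = wf_digraph.\<mu> (with_proj G) (\<lambda>_. 1)"

definition walk_measure :: "'a pair_pre_digraph \<Rightarrow> real \<Rightarrow> 'a \<Rightarrow> 'a \<Rightarrow> real" where
  "walk_measure G \<alpha> x y =
    (if y = x then \<alpha>
     else if y \<in> neighbors G x then (1 - \<alpha>) / real (card (neighbors G x))
     else 0)"

definition transport_plans ::
  "'a pair_pre_digraph \<Rightarrow> ('a \<Rightarrow> real) \<Rightarrow> ('a \<Rightarrow> real) \<Rightarrow> ('a \<times> 'a \<Rightarrow> real) set" where
  "transport_plans G m1 m2 =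
    {p. (\<forall>z \<in> pverts G \<times> pverts G. p z \<in> {0..1}) \<and>
        (\<forall>x \<in> pverts G. ((\<lambda>y. p (x, y)) has_sum m1 x) (pverts G)) \<and>
        (\<forall>y \<in> pverts G. ((\<lambda>x. p (x, y)) has_sum m2 y) (pverts G))}"

text \<open>
  The cost is summed in the extended reals, where a family of nonnegative terms is always
  summable and \<open>\<infinity> * 0 = 0\<close>.
\<close>

definition wasserstein ::
  "'a pair_pre_digraph \<Rightarrow> ('a \<Rightarrow> real) \<Rightarrow> ('a \<Rightarrow> real) \<Rightarrow> ereal" where
  "wasserstein G m1 m2 =
    (INF p \<in> transport_plans G m1 m2.
      \<Sum>\<^sub>\<infinity>(x, y) \<in> pverts G \<times> pverts G. graph_dist G x y * ereal (p (x, y)))"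

text \<open>
  Meaningful for distinct vertices at finite distance; there the Wasserstein distance is
  finite, so passing to the reals loses nothing.
\<close>

definition ollivier_curvature :: "'a pair_pre_digraph \<Rightarrow> real \<Rightarrow> 'a \<Rightarrow> 'a \<Rightarrow> real" where
  "ollivier_curvature G \<alpha> x y =
    real_of_ereal (1 - wasserstein G (walk_measure G \<alpha> x) (walk_measure G \<alpha> y) / graph_dist G x y)"

text \<open>The limit is one-sided because \<open>\<alpha>\<close> ranges over \<open>[0, 1]\<close>.\<close>

definition LLY_curvature :: "'a pair_pre_digraph \<Rightarrow> 'a \<Rightarrow> 'a \<Rightarrow> real" where
  "LLY_curvature G x y = Lim (at_left 1) (\<lambda>\<alpha>. ollivier_curvature G \<alpha> x y / (1 - \<alpha>))"

definition strong_product ::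
  "'a pair_pre_digraph \<Rightarrow> 'b pair_pre_digraph \<Rightarrow> ('a \<times> 'b) pair_pre_digraph"
    (infixl \<open>\<boxtimes>\<close> 70) where
  "G \<boxtimes> H =
    \<lparr> pverts = pverts G \<times> pverts H,
      parcs = {((x1, y1), (x2, y2)).
        (x1, y1) \<in> pverts G \<times> pverts H \<and> (x2, y2) \<in> pverts G \<times> pverts H \<and>
        (x1, y1) \<noteq> (x2, y2) \<and>
        x2 \<in> closed_neighbors G x1 \<and> y2 \<in> closed_neighbors H y1} \<rparr>"

lemma neighbors_strong_product:
  assumes "locally_finite_graph G" "locally_finite_graph H"
    and "x \<in> pverts G" "y \<in> pverts H"
  shows "neighbors (G \<boxtimes> H) (x, y) = closed_neighbors G x \<times> closed_neighbors H y - {(x, y)}"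
proof -
  interpret G: locally_finite_graph G by fact
  interpret H: locally_finite_graph H by fact
  show ?thesis
    using assms(3,4) G.arc_snd_in_verts H.arc_snd_in_verts
    by (fastforce simp: neighbors_def closed_neighbors_def strong_product_def)
qed

lemma locally_finite_graph_strong_product:
  assumes "locally_finite_graph G" "locally_finite_graph H"
  shows "locally_finite_graph (G \<boxtimes> H)"
proof -
  interpret G: locally_finite_graph G by fact
  interpret H: locally_finite_graph H by fact
  have symG: "(x, y) \<in> parcs G \<longleftrightarrow> (y, x) \<in> parcs G" for x y
    using G.pair_sym_arcs by (auto simp: symmetric_def sym_def)
  have symH: "(x, y) \<in> parcs H \<longleftrightarrow> (y, x) \<in> parcs H" for x y
    using H.pair_sym_arcs by (auto simp: symmetric_def sym_def)
  have "sym (parcs (G \<boxtimes> H))"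
    using symG symH
    by (auto simp: sym_def strong_product_def neighbors_def closed_neighbors_def)
  then have "symmetric (with_proj (G \<boxtimes> H))"
    by (simp add: symmetric_def)
  moreover have "finite (neighbors (G \<boxtimes> H) z)" if "z \<in> pverts (G \<boxtimes> H)" for z
  proof (cases z)
    case (Pair x y)
    with that have "x \<in> pverts G" "y \<in> pverts H"
      by (auto simp: strong_product_def)
    then show ?thesis
      using assms Pair G.locally_finite H.locally_finite
      by (simp add: neighbors_strong_product closed_neighbors_def)
  qed
  ultimately show ?thesis
    by unfold_locales (auto simp: strong_product_def)
qed

lemma regular_graph_strong_product:
  assumes "locally_finite_graph G" "locally_finite_graph H"
    and "regular_graph G dG" "regular_graph H dH"
  shows "regular_graph (G \<boxtimes> H) (dG + dH + dG * dH)"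
  unfolding regular_graph_def
proof
  interpret G: locally_finite_graph G by fact
  interpret H: locally_finite_graph H by fact
  fix z assume "z \<in> pverts (G \<boxtimes> H)"
  then obtain x y where z: "z = (x, y)" and x: "x \<in> pverts G" and y: "y \<in> pverts H"
    by (auto simp: strong_product_def)
  have "x \<notin> neighbors G x" "y \<notin> neighbors H y"
    using G.pair_no_loops H.pair_no_loops by (fastforce simp: neighbors_def)+
  then have "card (closed_neighbors G x) = Suc dG" "card (closed_neighbors H y) = Suc dH"
    using x y assms(3,4) G.locally_finite[OF x] H.locally_finite[OF y]
    by (auto simp: closed_neighbors_def regular_graph_def)
  moreover have "(x, y) \<in> closed_neighbors G x \<times> closed_neighbors H y"
    by (simp add: closed_neighbors_def)
  ultimately show "card (neighbors (G \<boxtimes> H) z) = dG + dH + dG * dH"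
    using assms(1,2) x y
    by (simp add: z neighbors_strong_product card_Diff_singleton card_cartesian_product)
qed

end

(*
The optimal cost of transporting c * 1_{N[y1]} + e * 1_{y1} to c * 1_{N[y2]} + e * 1_{y2} in H,
for an edge y1 y2, is a function V(c, e), and the measures mu_y^alpha are of this shape with
c = (1 - alpha) / d_H and e = alpha - c.  By the triangle inequality the common mass of the two
measures can be left in place, so only the private neighbours (mass c each) and a surplus e have
to be moved, and V is piecewise linear with constants F0 and F1.  If e >= 0, the surplus may go from y1 straight to y2, and V(c, e) = e + c F0.
If -c <= e <= 0, the deficit puts mass -e at y2 (source) and y1 (target), and because an optimal
assignment is attained at a permutation, V is linear there: V(c, e) = (c + e) F0 - e F1.

In the strong product the same problem has optimal cost V((d_G + 1) c, e): projecting to H does not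
increase distances, and conversely a plan between the surplus masses lifts without extra cost,
since private neighbours stay in their fibre over N[x1] = N[x2], while mass at y1 or y2
really moves in H and can change from the fibre over x1 or x2 to any other fibre on the way.
For alpha > 1/2 the surplus e is nonnegative in both graphs, so kappa_alpha / (1 - alpha) is
constant there and the limit defining the Lin-Lu-Yau curvature exists.
*)

theory Submission
  imports Defs
begin

section \<open>Optimal transport between finite measures\<close>

text \<open>At \<open>\<alpha> = 0\<close> the deficit in \<open>H\<close> is all of
  \<open>c\<close>, so only F1 enters there. In the product the spike at the centre lies in a single
  fibre, whereas the ball mass is summed over \<open>d_G + 1\<close> fibres. With D the product
  degree, the relevant value is V((d_G + 1)/D, -1/D) = (d_G F0 + F1)/D, taken strictly inside the
  deficit interval as soon as d_G > 0. Since kappa_LLY = (d_H + 1 - F0)/d_H and kappa_0 = 1 - F1/d_H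
  in \<open>H\<close>, this is why kappa_0 of the product mixes both curvatures of \<open>H\<close>.
  Linearity at intermediate deficits is therefore the crux. Convexity of the optimal cost in the
  marginals gives one inequality only, and such a value function may in general bend. For the other
  inequality the marginals are completed to the constant 1 and one entry is made cheaper, until
  permutations using it and permutations avoiding it have the same lower bound F1. All transport
  takes place on the union of two closed balls, where distances are finite; the rest of a possibly
  infinite or disconnected graph carries no mass.\<close>

definition couplings ::
  "'a set \<Rightarrow> 'b set \<Rightarrow> ('a \<Rightarrow> real) \<Rightarrow> ('b \<Rightarrow> real) \<Rightarrow> ('a \<Rightarrow> 'b \<Rightarrow> real) set" where
  "couplings A B s t = {q. (\<forall>u\<in>A. \<forall>w\<in>B. 0 \<le> q u w) \<and>
     (\<forall>u\<in>A. (\<Sum>w\<in>B. q u w) = s u) \<and> (\<forall>w\<in>B. (\<Sum>u\<in>A. q u w) = t w)}"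

definition cost :: "('a \<Rightarrow> 'b \<Rightarrow> real) \<Rightarrow> 'a set \<Rightarrow> 'b set \<Rightarrow> ('a \<Rightarrow> 'b \<Rightarrow> real) \<Rightarrow> real" where
  "cost C A B q = (\<Sum>u\<in>A. \<Sum>w\<in>B. C u w * q u w)"

text \<open>An infimum in the reals, meaningful only for a nonempty set of plans with costs bounded
  below. Hence the recurring side conditions \<open>couplings A B s t \<noteq> {}\<close> and
  nonnegative \<open>C\<close>.\<close>

definition mincost ::
  "('a \<Rightarrow> 'b \<Rightarrow> real) \<Rightarrow> 'a set \<Rightarrow> 'b set \<Rightarrow> ('a \<Rightarrow> real) \<Rightarrow> ('b \<Rightarrow> real) \<Rightarrow> real" where
  "mincost C A B s t = (INF q\<in>couplings A B s t. cost C A B q)"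

lemma couplingsI:
  assumes "\<And>u w. u \<in> A \<Longrightarrow> w \<in> B \<Longrightarrow> 0 \<le> q u w"
    and "\<And>u. u \<in> A \<Longrightarrow> (\<Sum>w\<in>B. q u w) = s u"
    and "\<And>w. w \<in> B \<Longrightarrow> (\<Sum>u\<in>A. q u w) = t w"
  shows "q \<in> couplings A B s t"
  using assms by (auto simp: couplings_def)

lemma couplingsD:
  assumes "q \<in> couplings A B s t"
  shows "\<And>u w. u \<in> A \<Longrightarrow> w \<in> B \<Longrightarrow> 0 \<le> q u w"
    and "\<And>u. u \<in> A \<Longrightarrow> (\<Sum>w\<in>B. q u w) = s u"
    and "\<And>w. w \<in> B \<Longrightarrow> (\<Sum>u\<in>A. q u w) = t w"
  using assms by (auto simp: couplings_def)

lemma couplings_le: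
  assumes "finite A" "finite B" "q \<in> couplings A B s t" "u \<in> A" "w \<in> B"
  shows "q u w \<le> s u" "q u w \<le> t w"
proof -
  show "q u w \<le> s u"
    using couplingsD[OF assms(3)] assms member_le_sum[of w B "\<lambda>w. q u w"] by fastforce
  show "q u w \<le> t w"
    using couplingsD[OF assms(3)] assms member_le_sum[of u A "\<lambda>u. q u w"] by fastforce
qed

lemma couplings_eq_0:
  assumes "finite A" "finite B" "q \<in> couplings A B s t" "u \<in> A" "w \<in> B" "s u = 0 \<or> t w = 0"
  shows "q u w = 0"
  using couplings_le[OF assms(1-5)] couplingsD(1)[OF assms(3-5)] assms(6) by auto

lemma couplings_cong:
  assumes "\<And>u. u \<in> A \<Longrightarrow> s u = s' u" "\<And>w. w \<in> B \<Longrightarrow> t w = t' w"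
  shows "couplings A B s t = couplings A B s' t'"
  using assms by (auto simp: couplings_def)

lemma mincost_cong:
  assumes "\<And>u. u \<in> A \<Longrightarrow> s u = s' u" "\<And>w. w \<in> B \<Longrightarrow> t w = t' w"
  shows "mincost C A B s t = mincost C A B s' t'"
  using couplings_cong[of A s s' B t t'] assms by (simp add: mincost_def)

text \<open>The witness is the normalised product measure. If the total mass is 0, all masses vanish
  and the same formula works because division by zero gives 0.\<close>

lemma couplings_nonempty:
  assumes "finite A" "finite B" "\<And>u. u \<in> A \<Longrightarrow> 0 \<le> s u" "\<And>w. w \<in> B \<Longrightarrow> 0 \<le> t w"
    and eq: "sum s A = sum t B"
  shows "couplings A B s t \<noteq> {}"
proof -
  have s0: "s u = 0" if "sum t B = 0" "u \<in> A" for u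
    using that eq assms by (metis sum_nonneg_eq_0_iff)
  have t0: "t w = 0" if "sum t B = 0" "w \<in> B" for w
    using that assms by (metis sum_nonneg_eq_0_iff)
  have "(\<lambda>u w. s u * t w / sum t B) \<in> couplings A B s t"
  proof (rule couplingsI)
    show "0 \<le> s u * t w / sum t B" if "u \<in> A" "w \<in> B" for u w
      using that assms by (simp add: sum_nonneg)
    show "(\<Sum>w\<in>B. s u * t w / sum t B) = s u" if "u \<in> A" for u
      using s0[OF _ that] by (auto simp flip: sum_distrib_left sum_divide_distrib)
    show "(\<Sum>u\<in>A. s u * t w / sum t B) = t w" if "w \<in> B" for w
      using t0[OF _ that] eq by (auto simp flip: sum_distrib_right sum_divide_distrib)
  qed
  then show ?thesis by blast
qed

lemma cost_nonneg:
  assumes "\<forall>u\<in>A. \<forall>w\<in>B. 0 \<le> C u w" "q \<in> couplings A B s t"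
  shows "0 \<le> cost C A B q"
  unfolding cost_def using assms couplingsD(1)[OF assms(2)]
  by (intro sum_nonneg) (auto intro: mult_nonneg_nonneg)

lemma mincost_lower:
  assumes "\<forall>u\<in>A. \<forall>w\<in>B. 0 \<le> C u w" "q \<in> couplings A B s t"
  shows "mincost C A B s t \<le> cost C A B q"
  unfolding mincost_def
proof (rule cINF_lower)
  show "bdd_below (cost C A B ` couplings A B s t)"
    using cost_nonneg[OF assms(1)] by (intro bdd_belowI[of _ 0]) auto
qed fact

lemma mincost_greatest:
  assumes "couplings A B s t \<noteq> {}" "\<And>q. q \<in> couplings A B s t \<Longrightarrow> L \<le> cost C A B q"
  shows "L \<le> mincost C A B s t"
  unfolding mincost_def using assms by (intro cINF_greatest) auto

lemma mincost_mono:
  assumes "\<forall>u\<in>A. \<forall>w\<in>B. 0 \<le> C u w" and "couplings A' B' s' t' \<noteq> {}"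
    and "\<And>q. q \<in> couplings A' B' s' t' \<Longrightarrow> \<exists>p\<in>couplings A B s t. cost C A B p \<le> cost C' A' B' q"
  shows "mincost C A B s t \<le> mincost C' A' B' s' t'"
proof (rule mincost_greatest[OF assms(2)])
  fix q assume "q \<in> couplings A' B' s' t'"
  from assms(3)[OF this] obtain p where "p \<in> couplings A B s t" "cost C A B p \<le> cost C' A' B' q"
    by blast
  with mincost_lower[OF assms(1) this(1)] show "mincost C A B s t \<le> cost C' A' B' q" by fastforce
qed

text \<open>A row or column of zero mass forces zero entries, so plans on the two carriers
  correspond by restriction and by extension with zeros.\<close>

lemma mincost_restrict:
  assumes fin: "finite A'" "finite B'" and sub: "A \<subseteq> A'" "B \<subseteq> B'"
    and s0: "\<And>u. u \<in> A' - A \<Longrightarrow> s u = 0" and t0: "\<And>w. w \<in> B' - B \<Longrightarrow> t w = 0"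
    and C: "\<forall>u\<in>A'. \<forall>w\<in>B'. 0 \<le> C u w" and ne: "couplings A B s t \<noteq> {}"
  shows "mincost C A' B' s t = mincost C A B s t"
proof (rule antisym)
  have *: "\<exists>p\<in>couplings A B s t. cost C A B p \<le> cost C A' B' q" if q: "q \<in> couplings A' B' s t" for q
  proof (rule bexI[of _ q])
    have z: "q u w = 0" if "u \<in> A'" "w \<in> B'" "u \<notin> A \<or> w \<notin> B" for u w
      using couplings_eq_0[OF fin q that(1,2)] s0 t0 that by auto
    show "q \<in> couplings A B s t"
    proof (rule couplingsI)
      fix u assume "u \<in> A"
      then show "(\<Sum>w\<in>B. q u w) = s u"
        using couplingsD(2)[OF q, of u] sub z sum.mono_neutral_left[OF fin(2) sub(2), of "q u"] by auto
    next
      fix w assume "w \<in> B"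
      then show "(\<Sum>u\<in>A. q u w) = t w"
        using couplingsD(3)[OF q, of w] sub z sum.mono_neutral_left[OF fin(1) sub(1), of "\<lambda>u. q u w"] by auto
    qed (use couplingsD(1)[OF q] sub in auto)
    have "cost C A B q = (\<Sum>u\<in>A. \<Sum>w\<in>B'. C u w * q u w)"
      unfolding cost_def using z sub fin by (intro sum.cong[OF refl] sum.mono_neutral_left) auto
    also have "\<dots> = cost C A' B' q"
      unfolding cost_def using z sub fin by (intro sum.mono_neutral_left) (auto intro!: sum.neutral)
    finally show "cost C A B q \<le> cost C A' B' q" by simp
  qed
  define ext where "ext q = (\<lambda>u w. if u \<in> A \<and> w \<in> B then q u w else 0)" for q :: "'a \<Rightarrow> 'b \<Rightarrow> real"
  have ext: "ext q \<in> couplings A' B' s t \<and> cost C A' B' (ext q) \<le> cost C A B q"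
    if q: "q \<in> couplings A B s t" for q
  proof
    have r: "(\<Sum>w\<in>B'. ext q u w) = (if u \<in> A then \<Sum>w\<in>B. q u w else 0)" for u
      unfolding ext_def using sub fin by (auto intro!: sum.mono_neutral_cong_right)
    have c: "(\<Sum>u\<in>A'. ext q u w) = (if w \<in> B then \<Sum>u\<in>A. q u w else 0)" for w
      unfolding ext_def using sub fin by (auto intro!: sum.mono_neutral_cong_right)
    show "ext q \<in> couplings A' B' s t"
      using couplingsD[OF q] s0 t0 by (intro couplingsI) (simp_all add: r c, auto simp: ext_def)
    have "cost C A' B' (ext q) = (\<Sum>u\<in>A'. \<Sum>w\<in>B. C u w * ext q u w)"
      unfolding cost_def using sub fin by (intro sum.cong[OF refl] sum.mono_neutral_right) (auto simp: ext_def)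
    also have "\<dots> = (\<Sum>u\<in>A. \<Sum>w\<in>B. C u w * ext q u w)"
      using sub fin by (intro sum.mono_neutral_right) (auto simp: ext_def)
    also have "\<dots> = cost C A B q" unfolding cost_def by (simp add: ext_def)
    finally show "cost C A' B' (ext q) \<le> cost C A B q" by simp
  qed
  show "mincost C A' B' s t \<le> mincost C A B s t"
    using C ne ext by (intro mincost_mono) blast+
  have "couplings A' B' s t \<noteq> {}" using ext ne by blast
  then show "mincost C A B s t \<le> mincost C A' B' s t"
    using C sub by (intro mincost_mono *) auto
qed

lemma cost_add: "cost C A B (\<lambda>u w. p u w + q u w) = cost C A B p + cost C A B q"
  by (simp add: cost_def algebra_simps sum.distrib)

lemma cost_diff: "cost C A B (\<lambda>u w. p u w - q u w) = cost C A B p - cost C A B q"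
  by (simp add: cost_def algebra_simps sum_subtractf)

lemma cost_scale: "cost C A B (\<lambda>u w. c * q u w) = c * cost C A B q"
  by (simp add: cost_def sum_distrib_left algebra_simps)

text \<open>Plans scale by \<open>c\<close> and back by \<open>1/c\<close>. The case
  \<open>c = 0\<close> is separate: there every plan vanishes on the carriers.\<close>

lemma mincost_scale:
  assumes fin: "finite A" "finite B" and c: "0 \<le> c"
    and C: "\<forall>u\<in>A. \<forall>w\<in>B. 0 \<le> C u w" and ne: "couplings A B s t \<noteq> {}"
  shows "mincost C A B (\<lambda>u. c * s u) (\<lambda>w. c * t w) = c * mincost C A B s t"
proof -
  have up: "(\<lambda>u w. c * q u w) \<in> couplings A B (\<lambda>u. c * s u) (\<lambda>w. c * t w)"
    if "q \<in> couplings A B s t" "0 \<le> c" for c q s t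
    using couplingsD[OF that(1)] that(2) by (intro couplingsI) (auto simp flip: sum_distrib_left)
  show ?thesis
  proof (cases "c = 0")
    case True
    have "(\<lambda>u w. 0) \<in> couplings A B (\<lambda>u. c * s u) (\<lambda>w. c * t w)"
      by (auto simp: couplings_def True)
    moreover have "cost C A B q = 0" if "q \<in> couplings A B (\<lambda>u. c * s u) (\<lambda>w. c * t w)" for q
      unfolding cost_def using couplings_eq_0[OF fin that] True by (intro sum.neutral ballI) auto
    ultimately have "cost C A B ` couplings A B (\<lambda>u. c * s u) (\<lambda>w. c * t w) = {0}" by force
    then show ?thesis by (simp add: mincost_def True)
  next
    case False
    with c have c: "c > 0" by simp
    have up': "(\<lambda>u w. q u w / c) \<in> couplings A B s t"
      if "q \<in> couplings A B (\<lambda>u. c * s u) (\<lambda>w. c * t w)" for q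
      using up[OF that, of "1/c"] c by simp
    show ?thesis
    proof (rule antisym)
      have "mincost C A B (\<lambda>u. c * s u) (\<lambda>w. c * t w) / c \<le> mincost C A B s t"
      proof (rule mincost_greatest[OF ne])
        fix q assume "q \<in> couplings A B s t"
        from mincost_lower[OF C up[OF this]] c
        show "mincost C A B (\<lambda>u. c * s u) (\<lambda>w. c * t w) / c \<le> cost C A B q"
          by (simp add: cost_scale field_simps)
      qed
      then show "mincost C A B (\<lambda>u. c * s u) (\<lambda>w. c * t w) \<le> c * mincost C A B s t"
        using c by (simp add: field_simps)
      show "c * mincost C A B s t \<le> mincost C A B (\<lambda>u. c * s u) (\<lambda>w. c * t w)"
      proof (rule mincost_greatest)
        show "couplings A B (\<lambda>u. c * s u) (\<lambda>w. c * t w) \<noteq> {}" using up[of _ s t c] ne c by force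
        fix q assume q: "q \<in> couplings A B (\<lambda>u. c * s u) (\<lambda>w. c * t w)"
        have "mincost C A B s t \<le> cost C A B q / c"
          using mincost_lower[OF C up'[OF q]] cost_scale[of C A B "1/c" q] by simp
        then show "c * mincost C A B s t \<le> cost C A B q" using c by (simp add: field_simps)
      qed
    qed
  qed
qed

section \<open>Exchanging mass and leaving common mass in place\<close>

text \<open>
  The new plan differs from \<open>p\<close> by the rank-one matrix \<open>\<tau> * \<xi> u * \<rho> w\<close>, where
  \<open>\<xi>\<close> and \<open>\<rho>\<close> have total mass zero, so that the marginals do not change.
\<close>

lemma reroute:
  assumes fin: "finite A" "finite B" and p: "p \<in> couplings A B s t" and a: "a \<in> A" and b: "b \<in> B"
    and \<tau>: "0 \<le> \<tau>" "\<tau> \<le> s a - p a b" "\<tau> \<le> t b - p a b"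
    and swap: "\<And>u w. u \<in> A - {a} \<Longrightarrow> w \<in> B - {b} \<Longrightarrow> 0 < p u b \<Longrightarrow> 0 < p a w
      \<Longrightarrow> C u w + C a b \<le> C a w + C u b"
  obtains p' where "p' \<in> couplings A B s t" "cost C A B p' \<le> cost C A B p"
    "p' a b = p a b + \<tau>" "\<And>u w. u \<in> A - {a} \<Longrightarrow> w \<in> B - {b} \<Longrightarrow> p u w \<le> p' u w"
proof (cases "\<tau> = 0")
  case True
  then show ?thesis using that[of p] p by simp
next
  case False
  with \<tau> have t0: "\<tau> > 0" by simp
  define R Q where "R = s a - p a b" and "Q = t b - p a b"
  have RQ: "R > 0" "Q > 0" "\<tau> \<le> R" "\<tau> \<le> Q" using \<tau> t0 by (auto simp: R_def Q_def)
  \<comment> \<open>\<open>R\<close> and \<open>Q\<close> are the masses of row \<open>a\<close> and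
    column \<open>b\<close> outside the entry \<open>(a, b)\<close>. Both lose mass in proportion to
    their entries, so \<open>\<tau> \<le> R\<close> and \<open>\<tau> \<le> Q\<close> suffice for
    nonnegativity. The sources released from \<open>b\<close> and the targets released from
    \<open>a\<close> are paired independently, so the remaining entries can only grow.\<close>
  define \<xi> where "\<xi> u = (if u = a then -1 else p u b / Q)" for u
  define \<rho> where "\<rho> w = (if w = b then -1 else p a w / R)" for w
  note pD = couplingsD[OF p]
  have Q': "(\<Sum>u\<in>A-{a}. p u b) = Q"
    using pD(3)[OF b] sum.remove[OF fin(1) a, of "\<lambda>u. p u b"] by (simp add: Q_def)
  have R': "(\<Sum>w\<in>B-{b}. p a w) = R"
    using pD(2)[OF a] sum.remove[OF fin(2) b, of "\<lambda>w. p a w"] by (simp add: R_def)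
  have sQ: "(\<Sum>u\<in>A-{a}. p u b / Q) = 1" and sR: "(\<Sum>w\<in>B-{b}. p a w / R) = 1"
    using Q' R' RQ by (simp_all flip: sum_divide_distrib)
  have \<xi>_sum: "(\<Sum>u\<in>A. \<xi> u * f u) = (\<Sum>u\<in>A-{a}. p u b / Q * (f u - f a))" for f
  proof -
    have "(\<Sum>u\<in>A. \<xi> u * f u) = - f a + (\<Sum>u\<in>A-{a}. \<xi> u * f u)"
      by (simp add: sum.remove[OF fin(1) a] \<xi>_def)
    also have "\<dots> = - f a * (\<Sum>u\<in>A-{a}. p u b / Q) + (\<Sum>u\<in>A-{a}. p u b / Q * f u)"
      by (simp add: sQ \<xi>_def)
    also have "\<dots> = (\<Sum>u\<in>A-{a}. p u b / Q * (f u - f a))"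
      by (simp add: sum_distrib_left sum_subtractf right_diff_distrib diff_divide_distrib sum_negf mult.commute)
    finally show ?thesis .
  qed
  have \<rho>_sum: "(\<Sum>w\<in>B. \<rho> w * f w) = (\<Sum>w\<in>B-{b}. p a w / R * (f w - f b))" for f
  proof -
    have "(\<Sum>w\<in>B. \<rho> w * f w) = - f b + (\<Sum>w\<in>B-{b}. \<rho> w * f w)"
      by (simp add: sum.remove[OF fin(2) b] \<rho>_def)
    also have "\<dots> = - f b * (\<Sum>w\<in>B-{b}. p a w / R) + (\<Sum>w\<in>B-{b}. p a w / R * f w)"
      by (simp add: sR \<rho>_def)
    also have "\<dots> = (\<Sum>w\<in>B-{b}. p a w / R * (f w - f b))"
      by (simp add: sum_distrib_left sum_subtractf right_diff_distrib diff_divide_distrib sum_negf mult.commute)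
    finally show ?thesis .
  qed
  have s0: "sum \<xi> A = 0" "sum \<rho> B = 0"
    using \<xi>_sum[of "\<lambda>_. 1"] \<rho>_sum[of "\<lambda>_. 1"] by simp_all
  define p' where "p' u w = p u w + \<tau> * (\<xi> u * \<rho> w)" for u w
  show ?thesis
  proof (rule that[of p'])
    show "p' \<in> couplings A B s t"
    proof (rule couplingsI)
      fix u w assume uw: "u \<in> A" "w \<in> B"
      have nn: "0 \<le> p u w" "0 \<le> p a w" "0 \<le> p u b" using pD(1) uw a b by auto
      show "0 \<le> p' u w"
      proof -
        consider "u = a" "w = b" | "u = a" "w \<noteq> b" | "u \<noteq> a" "w = b" | "u \<noteq> a" "w \<noteq> b" by blast
        then show ?thesis
        proof cases
          case 2
          have "\<tau> * (p a w / R) \<le> R * (p a w / R)" using RQ nn by (intro mult_right_mono) auto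
          with 2 RQ show ?thesis by (simp add: p'_def \<xi>_def \<rho>_def)
        next
          case 3
          have "\<tau> * (p u b / Q) \<le> Q * (p u b / Q)" using RQ nn by (intro mult_right_mono) auto
          with 3 RQ show ?thesis by (simp add: p'_def \<xi>_def \<rho>_def)
        qed (use nn RQ t0 in \<open>auto simp: p'_def \<xi>_def \<rho>_def\<close>)
      qed
    next
      fix u assume "u \<in> A"
      then show "(\<Sum>w\<in>B. p' u w) = s u"
        using pD(2) by (simp add: p'_def sum.distrib s0 flip: sum_distrib_left)
    next
      fix w assume "w \<in> B"
      then show "(\<Sum>u\<in>A. p' u w) = t w"
        using pD(3) by (simp add: p'_def sum.distrib s0 flip: sum_distrib_left sum_distrib_right)
    qed
    have "cost C A B (\<lambda>u w. \<xi> u * \<rho> w) = (\<Sum>u\<in>A. \<xi> u * (\<Sum>w\<in>B. \<rho> w * C u w))"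
      by (simp add: cost_def sum_distrib_left mult_ac)
    \<comment> \<open>As \<open>\<xi>\<close> and \<open>\<rho>\<close> have total mass zero, the
      change of cost is a nonnegatively weighted sum of exchange differences. A weight is positive
      only where both \<open>p u b\<close> and \<open>p a w\<close> are, which is where
      \<open>swap\<close> is assumed.\<close>
    also have "\<dots> = (\<Sum>u\<in>A-{a}. p u b / Q * (\<Sum>w\<in>B-{b}. p a w / R * (C u w - C u b - (C a w - C a b))))"
      by (simp only: \<xi>_sum \<rho>_sum flip: sum_subtractf right_diff_distrib)
    also have "\<dots> = (\<Sum>u\<in>A-{a}. \<Sum>w\<in>B-{b}. p u b / Q * (p a w / R) * (C u w - C u b - (C a w - C a b)))"
      by (simp only: sum_distrib_left mult.assoc)
    also have "\<dots> \<le> 0"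
    proof (intro sum_nonpos)
      fix u w assume uw: "u \<in> A - {a}" "w \<in> B - {b}"
      then have nn: "0 \<le> p u b" "0 \<le> p a w" using pD(1) a b by auto
      show "p u b / Q * (p a w / R) * (C u w - C u b - (C a w - C a b)) \<le> 0"
      proof (cases "p u b = 0 \<or> p a w = 0")
        case False
        with nn have "0 < p u b" "0 < p a w" by auto
        with swap[OF uw this] RQ show ?thesis by (intro mult_nonneg_nonpos) auto
      qed auto
    qed
    finally have "\<tau> * cost C A B (\<lambda>u w. \<xi> u * \<rho> w) \<le> 0" using t0 by (intro mult_nonneg_nonpos) auto
    moreover have "p' = (\<lambda>u w. p u w + \<tau> * (\<xi> u * \<rho> w))" by (simp add: p'_def fun_eq_iff)
    ultimately show "cost C A B p' \<le> cost C A B p" by (simp add: cost_add cost_scale)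
    show "p' a b = p a b + \<tau>" by (simp add: p'_def \<xi>_def \<rho>_def)
    show "p u w \<le> p' u w" if "u \<in> A - {a}" "w \<in> B - {b}" for u w
      using that RQ t0 pD(1) a b by (auto simp: p'_def \<xi>_def \<rho>_def)
  qed
qed

text \<open>One vertex at a time: at the entry \<open>(z, z)\<close> the exchange condition of
  \<open>reroute\<close> is the triangle inequality through \<open>z\<close>. Entries outside row
  and column \<open>z\<close> do not decrease, so the diagonal entries already raised stay large
  enough.\<close>

lemma keep_common_mass:
  assumes fin: "finite S" and p: "p \<in> couplings S S s t"
    and k: "\<forall>z\<in>S. k z \<le> s z \<and> k z \<le> t z"
    and C0: "\<forall>z\<in>S. C z z = 0"
    and tri: "\<forall>u\<in>S. \<forall>v\<in>S. \<forall>w\<in>S. C u w \<le> C u v + C v w"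
    and Z: "finite Z" "Z \<subseteq> S"
  shows "\<exists>p'\<in>couplings S S s t. cost C S S p' \<le> cost C S S p \<and> (\<forall>z\<in>Z. k z \<le> p' z z)"
  using Z
proof (induction Z rule: finite_induct)
  case empty
  then show ?case using p by auto
next
  case (insert z Z)
  then obtain p' where p': "p' \<in> couplings S S s t" "cost C S S p' \<le> cost C S S p"
    "\<forall>z\<in>Z. k z \<le> p' z z" by auto
  have z: "z \<in> S" using insert by auto
  note le = couplings_le[OF fin fin p'(1) z z]
  show ?case
  proof (rule reroute[OF fin fin p'(1) z z, of "max 0 (k z - p' z z)" C])
    show "max 0 (k z - p' z z) \<le> s z - p' z z" "max 0 (k z - p' z z) \<le> t z - p' z z"
      using le k z by auto
    show "C u w + C z z \<le> C z w + C u z" if "u \<in> S - {z}" "w \<in> S - {z}" for u w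
      using tri C0 that z by fastforce
    fix q assume q: "q \<in> couplings S S s t" "cost C S S q \<le> cost C S S p'"
      "q z z = p' z z + max 0 (k z - p' z z)"
      "\<And>u w. u \<in> S - {z} \<Longrightarrow> w \<in> S - {z} \<Longrightarrow> p' u w \<le> q u w"
    have "k v \<le> q v v" if "v \<in> insert z Z" for v
    proof (cases "v = z")
      case False
      then have "k v \<le> p' v v" "v \<in> S - {z}" using that p'(3) insert by auto
      with q(4)[of v v] show ?thesis by auto
    qed (use q in auto)
    moreover have "cost C S S q \<le> cost C S S p" using q(2) p'(2) by linarith
    ultimately show ?thesis using q(1) by blast
  qed auto
qed

lemma cost_diagonal:
  assumes "finite S" "\<forall>z\<in>S. C z z = 0"
  shows "cost C S S (\<lambda>u w. if u = w then k u else 0) = 0"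
  unfolding cost_def using assms by (auto intro!: sum.neutral)

lemma couplings_add_diagonal:
  assumes "finite S" "\<forall>z\<in>S. 0 \<le> k z" "q \<in> couplings S S s t"
  shows "(\<lambda>u w. q u w + (if u = w then k u else 0)) \<in> couplings S S (\<lambda>u. k u + s u) (\<lambda>u. k u + t u)"
  using assms couplingsD[OF assms(3)]
  by (intro couplingsI) (auto simp: sum.distrib)

lemma mincost_add_diagonal_le:
  assumes "finite S" "\<forall>z\<in>S. 0 \<le> k z" "\<forall>z\<in>S. C z z = 0"
    and "\<forall>u\<in>S. \<forall>w\<in>S. 0 \<le> C u w" and "couplings S S s t \<noteq> {}"
  shows "mincost C S S (\<lambda>u. k u + s u) (\<lambda>u. k u + t u) \<le> mincost C S S s t"
proof (rule mincost_mono)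
  fix q assume q: "q \<in> couplings S S s t"
  show "\<exists>p\<in>couplings S S (\<lambda>u. k u + s u) (\<lambda>u. k u + t u). cost C S S p \<le> cost C S S q"
  proof (rule bexI[OF _ couplings_add_diagonal[OF assms(1,2) q]])
    show "cost C S S (\<lambda>u w. q u w + (if u = w then k u else 0)) \<le> cost C S S q"
      using cost_diagonal[of S C k] assms(1,3) by (simp add: cost_add)
  qed
qed (use assms in auto)

text \<open>For the harder inequality, a plan is first modified by \<open>keep_common_mass\<close>
  so that its diagonal dominates \<open>k\<close>; the diagonal part is then subtracted, and it
  costs nothing.\<close>

lemma mincost_add_diagonal:
  assumes fin: "finite S" and nn: "\<forall>z\<in>S. 0 \<le> k z" "\<forall>z\<in>S. 0 \<le> s z"
      "\<forall>z\<in>S. 0 \<le> t z" and C0: "\<forall>z\<in>S. C z z = 0"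
    and C: "\<forall>u\<in>S. \<forall>w\<in>S. 0 \<le> C u w"
    and tri: "\<forall>u\<in>S. \<forall>v\<in>S. \<forall>w\<in>S. C u w \<le> C u v + C v w"
    and ne: "couplings S S s t \<noteq> {}"
  shows "mincost C S S (\<lambda>u. k u + s u) (\<lambda>u. k u + t u) = mincost C S S s t"
proof (rule antisym)
  let ?s = "\<lambda>u. k u + s u" and ?t = "\<lambda>u. k u + t u"
  show "mincost C S S ?s ?t \<le> mincost C S S s t"
    using assms by (intro mincost_add_diagonal_le) auto
  show "mincost C S S s t \<le> mincost C S S ?s ?t"
  proof (rule mincost_mono[OF C])
    show "couplings S S ?s ?t \<noteq> {}" using couplings_add_diagonal[OF fin nn(1)] ne by blast
    fix q assume q: "q \<in> couplings S S ?s ?t"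
    have "\<exists>p'\<in>couplings S S ?s ?t. cost C S S p' \<le> cost C S S q \<and> (\<forall>z\<in>S. k z \<le> p' z z)"
      by (rule keep_common_mass[OF fin q]) (use fin nn C0 tri in auto)
    then obtain p where p: "p \<in> couplings S S ?s ?t" "cost C S S p \<le> cost C S S q"
      "\<And>z. z \<in> S \<Longrightarrow> k z \<le> p z z" by blast
    show "\<exists>p\<in>couplings S S s t. cost C S S p \<le> cost C S S q"
    proof (rule bexI)
      show "(\<lambda>u w. p u w - (if u = w then k u else 0)) \<in> couplings S S s t"
        using couplingsD[OF p(1)] p(3) fin by (intro couplingsI) (auto simp: sum_subtractf)
      show "cost C S S (\<lambda>u w. p u w - (if u = w then k u else 0)) \<le> cost C S S q"
        using p(2) cost_diagonal[of S C k] fin C0 by (simp add: cost_diff)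
    qed
  qed
qed

section \<open>Assignments and linearity of the optimal cost\<close>

text \<open>The induction of Halmos and Vaughan, which distinguishes whether some proper nonempty
  subset meets Hall's condition with equality.\<close>

lemma hall_marriage:
  assumes "finite A" "\<forall>i\<in>A. finite (N i)" "\<forall>S\<subseteq>A. card S \<le> card (\<Union>(N ` S))"
  shows "\<exists>f. inj_on f A \<and> (\<forall>i\<in>A. f i \<in> N i)"
  using assms
proof (induction "card A" arbitrary: A N rule: less_induct)
  case less
  note fin = less.prems(1,2) and hall = less.prems(3)[rule_format]
  consider "A = {}"
    | "A \<noteq> {}" "\<forall>S. S \<subset> A \<longrightarrow> S \<noteq> {} \<longrightarrow> card S < card (\<Union>(N ` S))"
    | S where "S \<subset> A" "S \<noteq> {}" "card (\<Union>(N ` S)) \<le> card S"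
    using not_less by blast
  then show ?case
  proof cases
    case 1
    then show ?thesis by simp
  next
    case 2
    \<comment> \<open>No proper nonempty subset is tight, so one target can be spared:
      \<open>a\<close> may take any \<open>x\<close> in \<open>N a\<close>.\<close>
    then obtain a where a: "a \<in> A" by blast
    have "card {a} \<le> card (N a)" using hall[of "{a}"] a by simp
    then have "N a \<noteq> {}" by auto
    then obtain x where x: "x \<in> N a" by blast
    have "\<exists>f. inj_on f (A - {a}) \<and> (\<forall>i\<in>A - {a}. f i \<in> N i - {x})"
    proof (rule less.hyps)
      show "card (A - {a}) < card A" using a fin by (intro card_Diff1_less)
      show "\<forall>S\<subseteq>A - {a}. card S \<le> card (\<Union>i\<in>S. N i - {x})"
      proof (intro allI impI)
        fix S assume S: "S \<subseteq> A - {a}"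
        show "card S \<le> card (\<Union>i\<in>S. N i - {x})"
        proof (cases "S = {}")
          case False
          with S a 2(2) have "card S < card (\<Union>(N ` S))" by auto
          moreover have "(\<Union>i\<in>S. N i - {x}) = \<Union>(N ` S) - {x}" by blast
          moreover have "card (\<Union>(N ` S)) \<le> card (\<Union>(N ` S) - {x}) + 1"
            by (simp add: card_Diff_singleton_if) linarith
          ultimately show ?thesis by simp
        qed simp
      qed
    qed (use fin in auto)
    then obtain f where f: "inj_on f (A - {a})" "\<forall>i\<in>A - {a}. f i \<in> N i - {x}" by blast
    have "inj_on (f(a := x)) A" using f by (auto simp: inj_on_def)
    moreover have "\<forall>i\<in>A. (f(a := x)) i \<in> N i" using f x by auto
    ultimately show ?thesis by blast
  next
    case 3
    \<comment> \<open>The tight set \<open>S\<close> uses up all of \<open>M\<close>. Hall's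
      condition for \<open>T \<union> S\<close>, less \<open>card M = card S\<close>, is Hall's
      condition for \<open>T\<close> with \<open>M\<close> removed.\<close>
    define M where "M = \<Union>(N ` S)"
    have finS: "finite S" using 3(1) fin finite_subset by blast
    have finM: "finite M" using 3(1) fin finS by (auto simp: M_def)
    have cM: "card M = card S" using 3 hall[of S] by (auto simp: M_def)
    have "\<exists>f. inj_on f S \<and> (\<forall>i\<in>S. f i \<in> N i)"
    proof (rule less.hyps)
      show "card S < card A" using psubset_card_mono[OF fin(1) 3(1)] .
    qed (use 3(1) fin hall finS in auto)
    then obtain f where f: "inj_on f S" "\<forall>i\<in>S. f i \<in> N i" by blast
    have "\<exists>g. inj_on g (A - S) \<and> (\<forall>i\<in>A - S. g i \<in> N i - M)"
    proof (rule less.hyps)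
      show "card (A - S) < card A" using 3(1,2) fin by (intro psubset_card_mono) auto
      show "\<forall>T\<subseteq>A - S. card T \<le> card (\<Union>i\<in>T. N i - M)"
      proof (intro allI impI)
        fix T assume T: "T \<subseteq> A - S"
        then have "finite T" using fin finite_subset by blast
        then have "card T + card S = card (T \<union> S)" using finS T by (subst card_Un_disjoint) auto
        also have "\<dots> \<le> card (\<Union>(N ` (T \<union> S)))" using T 3(1) by (intro hall) auto
        also have "\<Union>(N ` (T \<union> S)) = (\<Union>i\<in>T. N i - M) \<union> M" by (auto simp: M_def)
        also have "card \<dots> \<le> card (\<Union>i\<in>T. N i - M) + card M" by (rule card_Un_le)
        finally show "card T \<le> card (\<Union>i\<in>T. N i - M)" using cM by simp
      qed
    qed (use fin in auto)
    then obtain g where g: "inj_on g (A - S)" "\<forall>i\<in>A - S. g i \<in> N i - M" by blast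
    have gf: "g i \<noteq> f j" "f j \<noteq> g i" if "i \<in> A" "i \<notin> S" "j \<in> S" for i j
    proof -
      have "f j \<in> M" using f(2) that by (auto simp: M_def)
      moreover have "g i \<notin> M" using g(2) that by blast
      ultimately show "g i \<noteq> f j" "f j \<noteq> g i" by metis+
    qed
    have "inj_on (\<lambda>i. if i \<in> S then f i else g i) A"
    proof (rule inj_onI)
      fix i j assume "i \<in> A" "j \<in> A" "(if i \<in> S then f i else g i) = (if j \<in> S then f j else g j)"
      then show "i = j"
        using f(1) g(1) gf by (cases "i \<in> S"; cases "j \<in> S") (auto dest: inj_onD)
    qed
    moreover have "\<forall>i\<in>A. (if i \<in> S then f i else g i) \<in> N i" using f g by auto
    ultimately show ?thesis by blast
  qed
qed

text \<open>Double counting verifies Hall's condition for the support of \<open>M\<close>: the rows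
  in \<open>S\<close> carry mass \<open>r * card S\<close>, all of it in columns of capacity
  \<open>r\<close> that are neighbours of \<open>S\<close>.\<close>

lemma positive_matching:
  assumes fin: "finite A" "finite B" and M: "M \<in> couplings A B (\<lambda>_. r) (\<lambda>_. r)" and r: "0 < r"
    and card: "card A = card B"
  obtains \<sigma> where "bij_betw \<sigma> A B" "\<forall>u\<in>A. 0 < M u (\<sigma> u)"
proof -
  note MD = couplingsD[OF M]
  define N where "N u = {w\<in>B. 0 < M u w}" for u
  have "\<exists>f. inj_on f A \<and> (\<forall>u\<in>A. f u \<in> N u)"
  proof (rule hall_marriage[OF fin(1)])
    show "\<forall>u\<in>A. finite (N u)" using fin by (simp add: N_def)
    show "\<forall>S\<subseteq>A. card S \<le> card (\<Union>(N ` S))"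
    proof (intro allI impI)
      fix S assume S: "S \<subseteq> A"
      let ?N = "\<Union>(N ` S)"
      have NB: "?N \<subseteq> B" by (auto simp: N_def)
      have "r * card S = (\<Sum>u\<in>S. \<Sum>w\<in>B. M u w)"
        using S MD(2) by (simp add: subset_iff)
      also have "\<dots> = (\<Sum>u\<in>S. \<Sum>w\<in>?N. M u w)"
      proof (intro sum.cong[OF refl] sum.mono_neutral_right[OF fin(2) NB] ballI)
        fix u w assume "u \<in> S" "w \<in> B - ?N"
        then have "\<not> 0 < M u w" "0 \<le> M u w" using MD(1) S by (auto simp: N_def)
        then show "M u w = 0" by simp
      qed
      also have "\<dots> = (\<Sum>w\<in>?N. \<Sum>u\<in>S. M u w)" by (rule sum.swap)
      also have "\<dots> \<le> (\<Sum>w\<in>?N. \<Sum>u\<in>A. M u w)"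
        using S NB MD(1) fin by (intro sum_mono sum_mono2) auto
      also have "\<dots> = (\<Sum>w\<in>?N. r)"
        using NB MD(3) by (intro sum.cong) auto
      finally have "r * card S \<le> r * card ?N" by (simp add: mult.commute)
      then show "card S \<le> card ?N" using r by simp
    qed
  qed
  then obtain f where f: "inj_on f A" "\<forall>u\<in>A. f u \<in> N u" by blast
  then have sub: "f ` A \<subseteq> B" by (auto simp: N_def)
  have "f ` A = B" using card_subset_eq[OF fin(2) sub] card_image[OF f(1)] card by simp
  with f that[of f] show ?thesis by (auto simp: bij_betw_def N_def)
qed

lemma sum_matching:
  fixes f :: "'a \<Rightarrow> 'b \<Rightarrow> real"
  assumes "finite B" "\<sigma> \<in> A \<rightarrow> B"
  shows "(\<Sum>u\<in>A. \<Sum>w\<in>B. f u w * (if w = \<sigma> u then c else 0)) = (\<Sum>u\<in>A. f u (\<sigma> u) * c)"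
  using assms by (intro sum.cong) (auto simp: if_distrib cong: if_cong)

lemma couplings_matching:
  assumes "finite A" "finite B" "bij_betw \<sigma> A B" "0 \<le> c"
  shows "(\<lambda>u w. if w = \<sigma> u then c else 0) \<in> couplings A B (\<lambda>_. c) (\<lambda>_. c)"
proof (rule couplingsI)
  show "(\<Sum>w\<in>B. if w = \<sigma> u then c else 0) = c" if "u \<in> A" for u
    using that assms by (auto dest: bij_betwE)
  show "(\<Sum>u\<in>A. if w = \<sigma> u then c else 0) = c" if "w \<in> B" for w
  proof -
    have "(\<Sum>u\<in>A. if w = \<sigma> u then c else 0) = (\<Sum>v\<in>B. if w = v then c else 0)"
      by (rule sum.reindex_bij_betw[OF assms(3)])
    then show ?thesis using that assms by simp
  qed
qed (use assms in auto)

lemma cost_matching: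
  assumes "finite B" "bij_betw \<sigma> A B"
  shows "cost C A B (\<lambda>u w. if w = \<sigma> u then c else 0) = c * (\<Sum>u\<in>A. C u (\<sigma> u))"
proof -
  have "\<sigma> \<in> A \<rightarrow> B" using assms(2) by (auto dest: bij_betwE)
  then show ?thesis
    unfolding cost_def using sum_matching[OF assms(1), of \<sigma> A C c]
    by (simp add: sum_distrib_left mult.commute)
qed

text \<open>
  Peeling off positive perfect matchings one at a time, as in Birkhoff's theorem.
\<close>

lemma assignment:
  assumes fin: "finite A" "finite B" and card: "card A = card B"
    and M: "M \<in> couplings A B (\<lambda>_. r) (\<lambda>_. r)" and r: "0 \<le> r"
  shows "\<exists>\<sigma>. bij_betw \<sigma> A B \<and> r * (\<Sum>u\<in>A. C u (\<sigma> u)) \<le> cost C A B M"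
  using M r
proof (induction "card {x\<in>A \<times> B. 0 < M (fst x) (snd x)}" arbitrary: M r rule: less_induct)
  case less
  note M = less.prems(1) and MD = couplingsD[OF less.prems(1)]
  consider "A = {}" | "r = 0" | "A \<noteq> {}" "r > 0" using less.prems by fastforce
  then show ?case
  proof cases
    case 1
    then show ?thesis using card fin by (auto simp: cost_def bij_betw_def)
  next
    case 2
    obtain \<sigma> where "bij_betw \<sigma> A B" using finite_same_card_bij[OF fin card] by blast
    moreover have "cost C A B M = 0"
      unfolding cost_def using couplings_eq_0[OF fin M] 2 by (intro sum.neutral ballI) auto
    ultimately show ?thesis using 2 by auto
  next
    case 3
    obtain \<sigma> where \<sigma>: "bij_betw \<sigma> A B" "\<forall>u\<in>A. 0 < M u (\<sigma> u)"
      using positive_matching[OF fin M 3(2) card] by blast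
    have \<sigma>B: "\<sigma> u \<in> B" if "u \<in> A" for u using \<sigma>(1) that by (auto dest: bij_betwE)
    \<comment> \<open>With the smallest matched entry, subtracting the matching keeps all entries
      nonnegative and empties the one at \<open>v\<close>, so the support shrinks strictly.\<close>
    define \<epsilon> where "\<epsilon> = Min ((\<lambda>u. M u (\<sigma> u)) ` A)"
    have "\<epsilon> \<in> (\<lambda>u. M u (\<sigma> u)) ` A" unfolding \<epsilon>_def using 3 fin by (intro Min_in) auto
    then obtain v where v: "v \<in> A" "\<epsilon> = M v (\<sigma> v)" by blast
    have \<epsilon>le: "\<epsilon> \<le> M u (\<sigma> u)" if "u \<in> A" for u unfolding \<epsilon>_def using that fin by simp
    have \<epsilon>: "0 < \<epsilon>" "\<epsilon> \<le> r"
      using v \<sigma>(2) couplings_le(1)[OF fin M v(1) \<sigma>B[OF v(1)]] by auto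
    define P where "P u w = (if w = \<sigma> u then \<epsilon> else 0)" for u w
    have P: "P \<in> couplings A B (\<lambda>_. \<epsilon>) (\<lambda>_. \<epsilon>)"
      unfolding P_def[abs_def] using couplings_matching[OF fin \<sigma>(1)] \<epsilon> by simp
    define M' where "M' u w = M u w - P u w" for u w
    have M': "M' \<in> couplings A B (\<lambda>_. r - \<epsilon>) (\<lambda>_. r - \<epsilon>)"
    proof (rule couplingsI)
      show "0 \<le> M' u w" if "u \<in> A" "w \<in> B" for u w
        using that \<epsilon>le MD(1) by (simp add: M'_def P_def)
    qed (simp_all add: M'_def sum_subtractf MD couplingsD[OF P])
    have le: "M' u w \<le> M u w" for u w using \<epsilon> by (simp add: M'_def P_def)
    have "{x\<in>A \<times> B. 0 < M' (fst x) (snd x)} \<subset> {x\<in>A \<times> B. 0 < M (fst x) (snd x)}" (is "?L \<subset> ?R")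
    proof
      show "?L \<subseteq> ?R" using le by (auto intro: less_le_trans)
      have "(v, \<sigma> v) \<in> ?R" "(v, \<sigma> v) \<notin> ?L"
        using v \<sigma> \<sigma>B by (auto simp: M'_def P_def)
      then show "?L \<noteq> ?R" by blast
    qed
    then have "card ?L < card ?R" using fin by (intro psubset_card_mono) auto
    from less.hyps[OF this M'] \<epsilon> obtain \<sigma>' where \<sigma>': "bij_betw \<sigma>' A B"
      "(r - \<epsilon>) * (\<Sum>u\<in>A. C u (\<sigma>' u)) \<le> cost C A B M'" by auto
    define x y where "x = (\<Sum>u\<in>A. C u (\<sigma> u))" and "y = (\<Sum>u\<in>A. C u (\<sigma>' u))"
    have "M = (\<lambda>u w. M' u w + P u w)" by (simp add: M'_def fun_eq_iff)
    then have "cost C A B M = cost C A B M' + cost C A B P" by (metis cost_add)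
    moreover have "cost C A B P = \<epsilon> * x"
      unfolding P_def[abs_def] x_def by (rule cost_matching[OF fin(2) \<sigma>(1)])
    ultimately have c: "(r - \<epsilon>) * y + \<epsilon> * x \<le> cost C A B M" using \<sigma>'(2) by (simp add: y_def)
    \<comment> \<open>The cost of \<open>M\<close> is at least the mixture of \<open>x\<close> and
      \<open>y\<close> with weights \<open>\<epsilon>\<close> and \<open>r - \<epsilon>\<close>, so
      the cheaper of the two matchings serves.\<close>
    show ?thesis
    proof (cases "x \<le> y")
      case True
      then have "(r - \<epsilon>) * x \<le> (r - \<epsilon>) * y" using \<epsilon> by (intro mult_left_mono) auto
      then have "r * x \<le> cost C A B M" using c by (simp add: algebra_simps)
      then show ?thesis using \<sigma>(1) by (auto simp: x_def)
    next
      case False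
      then have "\<epsilon> * y \<le> \<epsilon> * x" using \<epsilon> by (intro mult_left_mono) auto
      then have "r * y \<le> cost C A B M" using c by (simp add: algebra_simps)
      then show ?thesis using \<sigma>'(1) by (auto simp: y_def)
    qed
  qed
qed

section \<open>Convexity of the optimal cost and the effect of one extra source and target\<close>

lemma mincost_affine_greatest:
  assumes "couplings A B s t \<noteq> {}" "0 \<le> k" "\<forall>q\<in>couplings A B s t. L \<le> k * cost C A B q + m"
  shows "L \<le> k * mincost C A B s t + m"
proof (cases "k = 0")
  case True
  then show ?thesis using assms by auto
next
  case False
  with assms(2) have k: "k > 0" by simp
  have "(L - m) / k \<le> mincost C A B s t"
    using assms(1,3) k by (intro mincost_greatest) (auto simp: field_simps)
  then show ?thesis using k by (simp add: field_simps)
qed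

text \<open>Mixing a plan of each problem gives a plan for the mixed marginals. Minimisers are not
  assumed to exist, so the bound passes through the two infima one after the other.\<close>

lemma mincost_convex:
  assumes C: "\<forall>u\<in>A. \<forall>w\<in>B. 0 \<le> C u w" and g: "0 \<le> g" "g \<le> 1"
    and ne: "couplings A B s t \<noteq> {}" "couplings A B s' t' \<noteq> {}"
  shows "mincost C A B (\<lambda>u. (1 - g) * s u + g * s' u) (\<lambda>w. (1 - g) * t w + g * t' w)
    \<le> (1 - g) * mincost C A B s t + g * mincost C A B s' t'" (is "?L \<le> _")
proof (rule mincost_affine_greatest[OF ne(1)]; (intro ballI)?)
  fix q assume q: "q \<in> couplings A B s t"
  have "?L \<le> g * mincost C A B s' t' + (1 - g) * cost C A B q"
  proof (rule mincost_affine_greatest[OF ne(2)]; (intro ballI)?)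
    fix q' assume q': "q' \<in> couplings A B s' t'"
    have "(\<lambda>u w. (1 - g) * q u w + g * q' u w) \<in>
      couplings A B (\<lambda>u. (1 - g) * s u + g * s' u) (\<lambda>w. (1 - g) * t w + g * t' w)"
      using couplingsD[OF q] couplingsD[OF q'] g
      by (intro couplingsI) (auto simp: sum.distrib simp flip: sum_distrib_left)
    from mincost_lower[OF C this]
    show "?L \<le> g * cost C A B q' + (1 - g) * cost C A B q"
      by (simp add: cost_add cost_scale)
  qed (use g in auto)
  then show "?L \<le> (1 - g) * cost C A B q + g * mincost C A B s' t'" by simp
qed (use g in auto)

lemma couplings_insert:
  fixes C :: "'a \<Rightarrow> 'b \<Rightarrow> real"
  assumes "finite A" "finite B" "a \<notin> A" "b \<notin> B" "0 \<le> e" and q: "q \<in> couplings A B s t"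
  defines "q' \<equiv> \<lambda>u w. if u = a \<and> w = b then e else if u \<in> A \<and> w \<in> B then q u w else 0"
  shows "q' \<in> couplings (insert a A) (insert b B) (s(a := e)) (t(b := e))"
    and "cost C (insert a A) (insert b B) q' = e * C a b + cost C A B q"
proof -
  have [simp]: "q' a b = e" "\<And>w. w \<in> B \<Longrightarrow> q' a w = 0" "\<And>u. u \<in> A \<Longrightarrow> q' u b = 0"
    "\<And>u w. u \<in> A \<Longrightarrow> w \<in> B \<Longrightarrow> q' u w = q u w"
    using assms by (auto simp: q'_def)
  note qD = couplingsD[OF q]
  have ne: "u \<noteq> a" if "u \<in> A" for u using that assms by blast
  have ne': "w \<noteq> b" if "w \<in> B" for w using that assms by blast
  show "q' \<in> couplings (insert a A) (insert b B) (s(a := e)) (t(b := e))"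
    by (rule couplingsI) (use assms(1-5) qD ne ne' in \<open>auto\<close>)
  show "cost C (insert a A) (insert b B) q' = e * C a b + cost C A B q"
    using assms(1-4) by (simp add: cost_def)
qed

lemma mincost_insert_le:
  assumes "finite A" "finite B" "a \<notin> A" "b \<notin> B" "0 \<le> e" "couplings A B s t \<noteq> {}"
    and "\<forall>u\<in>insert a A. \<forall>w\<in>insert b B. 0 \<le> C u w"
  shows "mincost C (insert a A) (insert b B) (s(a := e)) (t(b := e)) \<le> e * C a b + mincost C A B s t"
proof -
  let ?L = "mincost C (insert a A) (insert b B) (s(a := e)) (t(b := e))"
  have "?L \<le> 1 * mincost C A B s t + e * C a b"
  proof (rule mincost_affine_greatest; (intro ballI)?)
    fix q assume "q \<in> couplings A B s t"
    note * = couplings_insert[OF assms(1-5) this]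
    show "?L \<le> 1 * cost C A B q + e * C a b"
      using mincost_lower[OF assms(7) *(1)] *(2)[of C] by simp
  qed (use assms in auto)
  then show ?thesis by simp
qed

text \<open>Since the row of \<open>a\<close> and the column of \<open>b\<close> both have mass
  \<open>e\<close>, rerouting can raise the entry \<open>(a, b)\<close> to exactly \<open>e\<close>.
  This empties the rest of that row and column, and what remains is a plan from \<open>A\<close> to
  \<open>B\<close>.\<close>

lemma mincost_transfer:
  assumes fin: "finite A" "finite B" and ab: "a \<notin> A" "b \<notin> B" and e: "0 \<le> e"
    and ne: "couplings A B s t \<noteq> {}" and C: "\<forall>u\<in>insert a A. \<forall>w\<in>insert b B. 0 \<le> C u w"
    and swap: "\<forall>u\<in>A. \<forall>w\<in>B. C u w + C a b \<le> C a w + C u b"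
  shows "mincost C (insert a A) (insert b B) (s(a := e)) (t(b := e)) = e * C a b + mincost C A B s t"
proof (rule antisym)
  let ?A = "insert a A" and ?B = "insert b B"
  show "mincost C ?A ?B (s(a := e)) (t(b := e)) \<le> e * C a b + mincost C A B s t"
    using assms by (intro mincost_insert_le) auto
  show "e * C a b + mincost C A B s t \<le> mincost C ?A ?B (s(a := e)) (t(b := e))"
  proof (rule mincost_greatest)
    show "couplings ?A ?B (s(a := e)) (t(b := e)) \<noteq> {}"
      using couplings_insert(1)[OF fin ab e] ne by blast
    fix q assume q: "q \<in> couplings ?A ?B (s(a := e)) (t(b := e))"
    have fin': "finite ?A" "finite ?B" using fin by auto
    have qe: "q a b \<le> e" using couplings_le(1)[OF fin' q, of a b] by simp
    show "e * C a b + mincost C A B s t \<le> cost C ?A ?B q"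
    proof (rule reroute[OF fin' q, of a b "e - q a b" C])
      show "C u w + C a b \<le> C a w + C u b" if "u \<in> ?A - {a}" "w \<in> ?B - {b}" for u w
        using that swap by auto
      fix p assume p: "p \<in> couplings ?A ?B (s(a := e)) (t(b := e))" "cost C ?A ?B p \<le> cost C ?A ?B q"
        "p a b = q a b + (e - q a b)"
      note pD = couplingsD[OF p(1)]
      have ra: "(\<Sum>w\<in>B. p a w) = 0" using pD(2)[of a] p(3) fin ab by simp
      have rb: "(\<Sum>u\<in>A. p u b) = 0" using pD(3)[of b] p(3) fin ab by simp
      have pa: "p a w = 0" if "w \<in> B" for w
        using ra pD(1) that fin sum_nonneg_eq_0_iff[of B "p a"] by auto
      have pb: "p u b = 0" if "u \<in> A" for u
        using rb pD(1) that fin sum_nonneg_eq_0_iff[of A "\<lambda>u. p u b"] by auto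
      have "p \<in> couplings A B s t"
      proof (rule couplingsI)
        show "(\<Sum>w\<in>B. p u w) = s u" if "u \<in> A" for u
          using that pD(2)[of u] fin ab pb[OF that] by (auto split: if_splits)
        show "(\<Sum>u\<in>A. p u w) = t w" if "w \<in> B" for w
          using that pD(3)[of w] fin ab pa[OF that] by (auto split: if_splits)
      qed (use pD in auto)
      then have "mincost C A B s t \<le> cost C A B p" using C by (intro mincost_lower) auto
      moreover have "cost C ?A ?B p = e * C a b + cost C A B p"
        using fin ab pa pb p(3) by (simp add: cost_def)
      ultimately show ?thesis using p(2) by linarith
    qed (use e qe in auto)
  qed
qed

text \<open>
  For a plan with mass \<open>g\<close> at the extra pair, the missing mass \<open>1 - g\<close> is put on the entry
  \<open>(a, b)\<close>. The lower bound is the assignment lemma for the cost in which \<open>(a, b)\<close> is cheaper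
  by the Lagrange multiplier \<open>l\<close>.
\<close>

lemma mincost_interpolate:
  fixes C :: "'a \<Rightarrow> 'b \<Rightarrow> real"
  assumes fin: "finite A" "finite B" and card: "card A = card B" and ab: "a \<notin> A" "b \<notin> B"
    and g: "0 \<le> g" "g \<le> 1" and C: "\<forall>u\<in>insert a A. \<forall>w\<in>insert b B. 0 \<le> C u w"
  defines "F \<equiv> \<lambda>g. mincost C (insert a A) (insert b B) ((\<lambda>_. 1)(a := g)) ((\<lambda>_. 1)(b := g))"
  shows "F g = (1 - g) * mincost C A B (\<lambda>_. 1) (\<lambda>_. 1) + g * F 1"
proof -
  let ?A = "insert a A" and ?B = "insert b B" and ?F0 = "mincost C A B (\<lambda>_. 1) (\<lambda>_. 1)"
  have fin': "finite ?A" "finite ?B" and card': "card ?A = card ?B" using fin ab card by auto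
  have ne: "couplings A B (\<lambda>_. 1) (\<lambda>_. 1) \<noteq> {}"
    using couplings_nonempty[OF fin] card by simp
  have ne': "couplings ?A ?B ((\<lambda>_. 1)(a := h)) ((\<lambda>_. 1)(b := h)) \<noteq> {}" if "0 \<le> h" for h
    using couplings_insert(1)[OF fin ab that] ne by blast
  have F0: "F 0 = ?F0"
  proof -
    have "couplings A B ((\<lambda>_. 1)(a := 0)) ((\<lambda>_. 1)(b := 0)) = couplings A B (\<lambda>_. 1) (\<lambda>_. 1)"
      using ab by (intro couplings_cong) auto
    then have "F 0 = mincost C A B ((\<lambda>_. 1)(a := 0)) ((\<lambda>_. 1)(b := 0))"
      unfolding F_def using C ne fin' by (intro mincost_restrict) auto
    also have "\<dots> = ?F0" using ab by (intro mincost_cong) auto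
    finally show ?thesis .
  qed
  show ?thesis
  proof (rule antisym)
    have "F g = mincost C ?A ?B (\<lambda>u. (1 - g) * ((\<lambda>_. 1)(a := 0)) u + g * ((\<lambda>_. 1)(a := 1)) u)
        (\<lambda>w. (1 - g) * ((\<lambda>_. 1)(b := 0)) w + g * ((\<lambda>_. 1)(b := 1)) w)"
      unfolding F_def by (intro mincost_cong) auto
    also have "\<dots> \<le> (1 - g) * F 0 + g * F 1"
      unfolding F_def by (rule mincost_convex[OF C g ne' ne']) auto
    finally show "F g \<le> (1 - g) * ?F0 + g * F 1" by (simp add: F0)
  next
    \<comment> \<open>Chosen so that a permutation with \<open>a\<close> sent to \<open>b\<close>
      has reduced cost at least \<open>C a b - l + ?F0 = F 1\<close>, the lower bound that also
      holds for all other permutations.\<close>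
    define l where "l = C a b + ?F0 - F 1"
    have "F 1 \<le> 1 * C a b + ?F0"
      unfolding F_def by (rule mincost_insert_le) (use fin ab ne C in auto)
    then have l: "0 \<le> l" by (simp add: l_def)
    have Fg: "F g = mincost C ?A ?B ((\<lambda>_. 1)(a := g)) ((\<lambda>_. 1)(b := g))"
      by (simp only: F_def)
    have F1: "F 1 = mincost C ?A ?B (\<lambda>_. 1) (\<lambda>_. 1)"
      unfolding F_def by (intro mincost_cong) auto
    show "(1 - g) * ?F0 + g * F 1 \<le> F g"
      unfolding Fg
    proof (rule mincost_greatest[OF ne'[OF g(1)]])
      fix q assume q: "q \<in> couplings ?A ?B ((\<lambda>_. 1)(a := g)) ((\<lambda>_. 1)(b := g))"
      note qD = couplingsD[OF q]
      define E :: "'a \<Rightarrow> 'b \<Rightarrow> real" where "E u w = (if u = a \<and> w = b then 1 else 0)" for u w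
      have Erow: "(\<Sum>w\<in>?B. x * E u w) = (if u = a then x else 0)" for u x
        using fin' by (auto simp: E_def if_distrib cong: if_cong)
      have Ecol: "(\<Sum>u\<in>?A. x * E u w) = (if w = b then x else 0)" for w x
        using fin' by (auto simp: E_def if_distrib cong: if_cong)
      define M where "M u w = q u w + (1 - g) * E u w" for u w
      define C' where "C' u w = C u w - l * E u w" for u w
      have Ecost: "cost D ?A ?B E = D a b" for D :: "'a \<Rightarrow> 'b \<Rightarrow> real"
      proof -
        have "cost D ?A ?B E = (\<Sum>u\<in>?A. if u = a then D a b else 0)"
          unfolding cost_def
          by (intro sum.cong refl) (use fin' in \<open>auto simp: E_def if_distrib cong: if_cong\<close>)
        then show ?thesis using fin' by simp
      qed
      have "M \<in> couplings ?A ?B (\<lambda>_. 1) (\<lambda>_. 1)"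
      proof (rule couplingsI)
        show "0 \<le> M u w" if "u \<in> ?A" "w \<in> ?B" for u w
          using qD(1)[OF that] g by (simp add: M_def E_def)
        show "(\<Sum>w\<in>?B. M u w) = 1" if "u \<in> ?A" for u
          using qD(2)[OF that] Erow[of "1 - g" u] by (simp only: M_def sum.distrib) auto
        show "(\<Sum>u\<in>?A. M u w) = 1" if "w \<in> ?B" for w
          using qD(3)[OF that] Ecol[of "1 - g" w] by (simp only: M_def sum.distrib) auto
      qed
      from assignment[OF fin' card' this, of C'] obtain \<sigma> where \<sigma>: "bij_betw \<sigma> ?A ?B"
        "(\<Sum>u\<in>?A. C' u (\<sigma> u)) \<le> cost C' ?A ?B M" by auto
      have "cost C' ?A ?B M = cost C ?A ?B q + (1 - g) * C a b - l * q a b - l * (1 - g)"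
      proof -
        have "cost C' ?A ?B M = cost C ?A ?B M - (\<Sum>u\<in>?A. \<Sum>w\<in>?B. l * M u w * E u w)"
          by (simp add: cost_def C'_def sum_subtractf algebra_simps)
        also have "(\<Sum>u\<in>?A. \<Sum>w\<in>?B. l * M u w * E u w) = l * M a b"
          using Ecost[of "\<lambda>u w. l * M u w"] by (simp only: cost_def)
        also have "cost C ?A ?B M = cost C ?A ?B q + (1 - g) * C a b"
          unfolding M_def[abs_def] by (simp only: cost_add cost_scale Ecost)
        also have "l * M a b = l * q a b + l * (1 - g)"
          by (simp add: M_def E_def algebra_simps)
        finally show ?thesis by simp
      qed
      \<comment> \<open>If \<open>\<sigma>\<close> avoids the cheap entry, it is an ordinary plan
        for the unit masses. Otherwise it restricts to a matching of \<open>A\<close> with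
        \<open>B\<close>, and \<open>l\<close> compensates exactly.\<close>
      moreover have "F 1 \<le> (\<Sum>u\<in>?A. C' u (\<sigma> u))"
      proof (cases "\<sigma> a = b")
        case False
        have "F 1 \<le> (\<Sum>u\<in>?A. C u (\<sigma> u))"
          using mincost_lower[OF C couplings_matching[OF fin' \<sigma>(1), of 1]]
            cost_matching[OF fin'(2) \<sigma>(1), of C 1] by (simp add: F1)
        also have "\<dots> = (\<Sum>u\<in>?A. C' u (\<sigma> u))"
          using False by (intro sum.cong) (auto simp: C'_def E_def)
        finally show ?thesis .
      next
        case True
        have "bij_betw \<sigma> A B" using \<sigma>(1) ab True by (simp add: notIn_Un_bij_betw3[of a A \<sigma> B])
        note \<sigma>' = this
        have "?F0 \<le> (\<Sum>u\<in>A. C u (\<sigma> u))"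
          using mincost_lower[OF _ couplings_matching[OF fin \<sigma>', of 1], of C]
            cost_matching[OF fin(2) \<sigma>', of C 1] C by simp
        also have "\<dots> = (\<Sum>u\<in>A. C' u (\<sigma> u))"
          using ab by (intro sum.cong) (auto simp: C'_def E_def)
        finally show ?thesis using fin ab True by (simp add: C'_def E_def l_def)
      qed
      moreover have "0 \<le> l * q a b" using l qD(1) by simp
      ultimately have "F 1 \<le> cost C ?A ?B q + (1 - g) * C a b - l * (1 - g)" using \<sigma>(2) by linarith
      then show "(1 - g) * ?F0 + g * F 1 \<le> cost C ?A ?B q" by (simp add: l_def algebra_simps)
    qed
  qed
qed

section \<open>Graph distance and Wasserstein distance\<close>

text \<open>A natural-number substitute for \<open>graph_dist\<close>. For unreachable pairs the
  \<open>LEAST\<close> is unspecified, which explains the reachability assumptions below.\<close>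

definition hops :: "'a rel \<Rightarrow> 'a \<Rightarrow> 'a \<Rightarrow> nat" where
  "hops E u w = (LEAST k::nat. (u, w) \<in> E ^^ k)"

lemma hops_le: "(u, w) \<in> E ^^ k \<Longrightarrow> hops E u w \<le> k"
  by (simp add: hops_def Least_le)

lemma relpow_hops: "(u, w) \<in> E\<^sup>* \<Longrightarrow> (u, w) \<in> E ^^ hops E u w"
  unfolding hops_def by (rule LeastI_ex) (simp add: rtrancl_power)

lemma hops_self [simp]: "hops E u u = 0"
  using hops_le[of u u 0 E] by simp

lemma hops_triangle:
  assumes "(u, v) \<in> E\<^sup>*" "(v, w) \<in> E\<^sup>*"
  shows "hops E u w \<le> hops E u v + hops E v w"
  using relpow_hops[OF assms(1)] relpow_hops[OF assms(2)]
  by (intro hops_le) (auto simp: relpow_add)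

lemma hops_pos: "(u, w) \<in> E\<^sup>* \<Longrightarrow> u \<noteq> w \<Longrightarrow> 1 \<le> hops E u w"
  using relpow_hops[of u w E] by (cases "hops E u w") auto

lemma hops_arc: "(u, w) \<in> E \<Longrightarrow> u \<noteq> w \<Longrightarrow> hops E u w = 1"
  using hops_le[of u w 1 E] hops_pos[OF r_into_rtrancl, of u w E] by (simp add: le_antisym)

lemma hops_ge_2:
  assumes "(u, w) \<in> E\<^sup>*" "u \<noteq> w" "(u, w) \<notin> E"
  shows "2 \<le> hops E u w"
proof -
  have "hops E u w \<noteq> 1" using relpow_hops[OF assms(1)] assms(3) by auto
  then show ?thesis using hops_pos[OF assms(1,2)] by linarith
qed

lemma (in pair_wf_digraph) awalk_relpow:
  "u \<in> pverts G \<Longrightarrow> (u, w) \<in> parcs G ^^ k \<longleftrightarrow> (\<exists>p. awalk u p w \<and> length p = k)"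
proof (induction k arbitrary: u)
  case 0
  then show ?case by (auto simp: awalk_Nil_iff)
next
  case (Suc k)
  show ?case
  proof
    assume "(u, w) \<in> parcs G ^^ Suc k"
    then obtain v where v: "(u, v) \<in> parcs G" "(v, w) \<in> parcs G ^^ k" by (meson relpow_Suc_E2)
    then obtain p where "awalk v p w" "length p = k" using Suc.IH[of v] in_arcsD2 by auto
    with v have "awalk u ((u, v) # p) w \<and> length ((u, v) # p) = Suc k"
      by (simp add: awalk_Cons_iff)
    then show "\<exists>p. awalk u p w \<and> length p = Suc k" by blast
  next
    assume "\<exists>p. awalk u p w \<and> length p = Suc k"
    then obtain e p where "awalk u (e # p) w" "length p = k" by (metis length_Suc_conv)
    then have e: "e \<in> parcs G" "u = fst e" "awalk (snd e) p w" by (auto simp: awalk_Cons_iff)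
    then have "(snd e, w) \<in> parcs G ^^ k"
      using Suc.IH[of "snd e"] arc_snd_in_verts \<open>length p = k\<close> by auto
    with e show "(u, w) \<in> parcs G ^^ Suc k" by (metis prod.collapse relpow_Suc_I2)
  qed
qed

lemma (in pair_wf_digraph) graph_dist_eq_hops:
  assumes u: "u \<in> pverts G" and r: "(u, w) \<in> (parcs G)\<^sup>*"
  shows "graph_dist G u w = ereal (hops (parcs G) u w)"
proof -
  have len: "awalk_cost (\<lambda>_. 1) p = length p" for p :: "('a \<times> 'a) list"
    by (simp add: awalk_cost_def sum_list_triv)
  have "graph_dist G u w = (INF p\<in>{p. awalk u p w}. ereal (length p))"
    by (simp add: graph_dist_def \<mu>_def len)
  also have "\<dots> = ereal (hops (parcs G) u w)"
  proof (rule INF_eqI)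
    show "ereal (hops (parcs G) u w) \<le> ereal (length p)" if "p \<in> {p. awalk u p w}" for p
      using that awalk_relpow[OF u, of w "length p"] hops_le by auto
    obtain p where "awalk u p w" "length p = hops (parcs G) u w"
      using awalk_relpow[OF u] relpow_hops[OF r] by blast
    then show "y \<le> ereal (hops (parcs G) u w)" if "\<And>p. p \<in> {p. awalk u p w} \<Longrightarrow> y \<le> ereal (length p)" for y
      using that[of p] by simp
  qed
  finally show ?thesis .
qed

lemma transport_plan_eq_0:
  assumes p: "p \<in> transport_plans G m1 m2" and uw: "u \<in> pverts G" "w \<in> pverts G"
    and "m1 u = 0 \<or> m2 w = 0"
  shows "p (u, w) = 0"
  using assms(4)
proof
  assume "m1 u = 0"
  then show ?thesis
    using p uw by (intro nonneg_has_sum_le_0D[where f = "\<lambda>w. p (u, w)" and A = "pverts G"])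
      (auto simp: transport_plans_def)
next
  assume "m2 w = 0"
  then show ?thesis
    using p uw by (intro nonneg_has_sum_le_0D[where f = "\<lambda>u. p (u, w)" and A = "pverts G"])
      (auto simp: transport_plans_def)
qed

text \<open>Vanishing marginals force a plan to vanish off \<open>S \<times> S\<close>, even for
  infinite row sums. Infinite distances outside \<open>S\<close> do no harm because
  \<open>\<infinity> * 0 = 0\<close>, so both infima range over the same costs.\<close>

lemma wasserstein_eq_mincost:
  assumes fin: "finite S" and SV: "S \<subseteq> pverts G"
    and m0: "\<And>u. u \<in> pverts G - S \<Longrightarrow> m1 u = 0" "\<And>u. u \<in> pverts G - S \<Longrightarrow> m2 u = 0"
    and m1: "\<And>u. u \<in> S \<Longrightarrow> m1 u \<le> 1"
    and D: "\<And>u w. u \<in> S \<Longrightarrow> w \<in> S \<Longrightarrow> graph_dist G u w = ereal (C u w)"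
    and C: "\<forall>u\<in>S. \<forall>w\<in>S. 0 \<le> C u w" and ne: "couplings S S m1 m2 \<noteq> {}"
  shows "wasserstein G m1 m2 = ereal (mincost C S S m1 m2)"
proof -
  let ?V = "pverts G" and ?c = "\<lambda>p. \<Sum>\<^sub>\<infinity>(x, y) \<in> pverts G \<times> pverts G. graph_dist G x y * ereal (p (x, y))"
  have infsum_cost: "?c p = ereal (cost C S S q)"
    if z: "\<And>u w. u \<in> ?V \<Longrightarrow> w \<in> ?V \<Longrightarrow> u \<notin> S \<or> w \<notin> S \<Longrightarrow> p (u, w) = 0"
      and q: "\<And>u w. u \<in> S \<Longrightarrow> w \<in> S \<Longrightarrow> p (u, w) = q u w" for p q
  proof -
    have "?c p = (\<Sum>\<^sub>\<infinity>(x, y) \<in> S \<times> S. ereal (C x y * q x y))"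
    proof (rule infsum_cong_neutral)
      fix x assume "x \<in> ?V \<times> ?V - S \<times> S"
      then have "p x = 0" using z by (cases x) auto
      then show "(case x of (x, y) \<Rightarrow> graph_dist G x y * ereal (p (x, y))) = 0" by (cases x) simp
    qed (use SV in \<open>auto simp: D q\<close>)
    also have "\<dots> = ereal (cost C S S q)"
      using fin by (simp add: cost_def sum.cartesian_product case_prod_unfold)
    finally show ?thesis .
  qed
  have to_coupling: "(\<lambda>u w. p (u, w)) \<in> couplings S S m1 m2 \<and> ?c p = ereal (cost C S S (\<lambda>u w. p (u, w)))"
    if p: "p \<in> transport_plans G m1 m2" for p
  proof
    have z: "p (u, w) = 0" if "u \<in> ?V" "w \<in> ?V" "u \<notin> S \<or> w \<notin> S" for u w
      using transport_plan_eq_0[OF p that(1,2)] that m0 by auto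
    have pD: "\<And>u w. u \<in> ?V \<Longrightarrow> w \<in> ?V \<Longrightarrow> 0 \<le> p (u, w)"
      "\<And>u. u \<in> ?V \<Longrightarrow> ((\<lambda>w. p (u, w)) has_sum m1 u) ?V"
      "\<And>w. w \<in> ?V \<Longrightarrow> ((\<lambda>u. p (u, w)) has_sum m2 w) ?V"
      using p by (auto simp: transport_plans_def)
    show "(\<lambda>u w. p (u, w)) \<in> couplings S S m1 m2"
    proof (rule couplingsI)
      fix u assume u: "u \<in> S"
      have "((\<lambda>w. p (u, w)) has_sum m1 u) ?V \<longleftrightarrow> ((\<lambda>w. p (u, w)) has_sum m1 u) S"
        using u z SV by (intro has_sum_cong_neutral) auto
      then show "(\<Sum>w\<in>S. p (u, w)) = m1 u"
        using pD(2)[of u] u SV fin by (auto simp: has_sum_finite_iff)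
    next
      fix w assume w: "w \<in> S"
      have "((\<lambda>u. p (u, w)) has_sum m2 w) ?V \<longleftrightarrow> ((\<lambda>u. p (u, w)) has_sum m2 w) S"
        using w z SV by (intro has_sum_cong_neutral) auto
      then show "(\<Sum>u\<in>S. p (u, w)) = m2 w"
        using pD(3)[of w] w SV fin by (auto simp: has_sum_finite_iff)
    qed (use pD(1) SV in \<open>simp add: subset_iff\<close>)
    show "?c p = ereal (cost C S S (\<lambda>u w. p (u, w)))" using z by (intro infsum_cost) auto
  qed
  have of_coupling: "\<exists>p\<in>transport_plans G m1 m2. ?c p = ereal (cost C S S q)"
    if q: "q \<in> couplings S S m1 m2" for q
  proof (rule bexI)
    define p where "p x = (if x \<in> S \<times> S then q (fst x) (snd x) else 0)" for x
    note qD = couplingsD[OF q]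
    show "?c p = ereal (cost C S S q)" by (intro infsum_cost) (auto simp: p_def)
    show "p \<in> transport_plans G m1 m2"
      unfolding transport_plans_def
    proof (intro CollectI conjI ballI)
      fix x assume "x \<in> ?V \<times> ?V"
      \<comment> \<open>Membership in \<open>couplings\<close> bounds entries only through the
        marginals, hence the assumption that \<open>m1\<close> is at most 1 on
        \<open>S\<close>.\<close>
      show "p x \<in> {0..1}"
      proof (cases "x \<in> S \<times> S")
        case True
        then have "q (fst x) (snd x) \<le> m1 (fst x)" "m1 (fst x) \<le> 1" "0 \<le> q (fst x) (snd x)"
          using couplings_le(1)[OF fin fin q] qD(1) m1 by (auto simp: mem_Times_iff)
        then show ?thesis using True by (auto simp: p_def)
      qed (auto simp: p_def)
    next
      fix u assume u: "u \<in> ?V"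
      show "((\<lambda>w. p (u, w)) has_sum m1 u) ?V"
        by (cases "u \<in> S"; rule has_sum_finite_neutralI[where B = S])
          (use fin SV u qD(2)[of u] m0(1)[of u] in \<open>auto simp: p_def\<close>)
    next
      fix w assume w: "w \<in> ?V"
      show "((\<lambda>u. p (u, w)) has_sum m2 w) ?V"
        by (cases "w \<in> S"; rule has_sum_finite_neutralI[where B = S])
          (use fin SV w qD(3)[of w] m0(2)[of w] in \<open>auto simp: p_def\<close>)
    qed
  qed
  have "wasserstein G m1 m2 = (INF q\<in>couplings S S m1 m2. ereal (cost C S S q))"
    unfolding wasserstein_def
  proof (rule INF_eq)
    show "\<exists>q\<in>couplings S S m1 m2. ereal (cost C S S q) \<le> ?c p" if "p \<in> transport_plans G m1 m2" for p
      using to_coupling[OF that] by force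
    show "\<exists>p\<in>transport_plans G m1 m2. ?c p \<le> ereal (cost C S S q)" if "q \<in> couplings S S m1 m2" for q
      using of_coupling[OF that] by force
  qed
  also have "\<dots> = ereal (mincost C S S m1 m2)"
  proof -
    have "0 \<le> (INF q\<in>couplings S S m1 m2. ereal (cost C S S q))"
      using cost_nonneg[OF C] by (intro INF_greatest) auto
    moreover obtain q where "q \<in> couplings S S m1 m2" using ne by blast
    then have "(INF q\<in>couplings S S m1 m2. ereal (cost C S S q)) \<le> ereal (cost C S S q)"
      by (rule INF_lower)
    \<comment> \<open>Finiteness, from 0 below and the cost of one plan above, is what lets the
      extended infimum be read as a real one.\<close>
    ultimately have "\<bar>INF q\<in>couplings S S m1 m2. ereal (cost C S S q)\<bar> \<noteq> \<infinity>"
      by auto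
    then show ?thesis unfolding mincost_def by (simp add: ereal_INF)
  qed
  finally show ?thesis .
qed

text \<open>A uniform closed ball plus a spike at its centre; \<open>e\<close> may be negative.
  Closed balls of a strong product are products of closed balls, so this form suits both
  graphs.\<close>

definition ball_mass :: "'a pair_pre_digraph \<Rightarrow> 'a \<Rightarrow> real \<Rightarrow> real \<Rightarrow> 'a \<Rightarrow> real" where
  "ball_mass G z c e u = (if u \<in> closed_neighbors G z then c else 0) + (if u = z then e else 0)"

context locally_finite_graph
begin

lemma arc_sym: "(u, w) \<in> parcs G \<Longrightarrow> (w, u) \<in> parcs G"
  using pair_sym_arcs by (auto simp: symmetric_def sym_def)

lemma not_self_neighbor: "z \<notin> neighbors G z"
  using pair_no_loops by (fastforce simp: neighbors_def)

lemma closed_neighbors_verts: "z \<in> pverts G \<Longrightarrow> closed_neighbors G z \<subseteq> pverts G"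
  using in_arcsD2 by (auto simp: closed_neighbors_def neighbors_def)

lemma finite_closed_neighbors: "z \<in> pverts G \<Longrightarrow> finite (closed_neighbors G z)"
  using locally_finite by (simp add: closed_neighbors_def)

lemma card_closed_neighbors:
  "regular_graph G d \<Longrightarrow> z \<in> pverts G \<Longrightarrow> card (closed_neighbors G z) = Suc d"
  using locally_finite not_self_neighbor by (auto simp: closed_neighbors_def regular_graph_def)

lemma closed_neighbors_sym: "u \<in> closed_neighbors G w \<longleftrightarrow> w \<in> closed_neighbors G u"
  using arc_sym by (auto simp: closed_neighbors_def neighbors_def)

lemma ball_reachable:
  assumes arc: "(z1, z2) \<in> parcs G" and "u \<in> closed_neighbors G z1 \<union> closed_neighbors G z2"
    "w \<in> closed_neighbors G z1 \<union> closed_neighbors G z2"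
  shows "(u, w) \<in> (parcs G)\<^sup>*"
proof -
  have "(z1, v) \<in> (parcs G)\<^sup>* \<and> (v, z1) \<in> (parcs G)\<^sup>*"
    if "v \<in> closed_neighbors G z1 \<union> closed_neighbors G z2" for v
    using that arc arc_sym[OF arc] arc_sym[of z1 v] arc_sym[of z2 v]
    by (auto simp: closed_neighbors_def neighbors_def intro: converse_rtrancl_into_rtrancl)
  then show ?thesis using assms(2,3) by (meson rtrancl_trans)
qed

lemma sum_ball_mass:
  assumes "regular_graph G d" "z \<in> pverts G" "finite S" "closed_neighbors G z \<subseteq> S"
  shows "sum (ball_mass G z c e) S = (d + 1) * c + e"
proof -
  have "z \<in> S" using assms(4) by (auto simp: closed_neighbors_def)
  moreover have "(\<Sum>u\<in>S. if u \<in> closed_neighbors G z then c else 0) = (d + 1) * c"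
    using assms card_closed_neighbors[OF assms(1,2)]
    by (simp add: sum.If_cases Int_absorb1)
  ultimately show ?thesis using assms(3) by (simp add: ball_mass_def[abs_def] sum.distrib)
qed

lemma ball_mass_nonneg: "0 \<le> c \<Longrightarrow> 0 \<le> c + e \<Longrightarrow> 0 \<le> ball_mass G z c e u"
  by (auto simp: ball_mass_def closed_neighbors_def)

lemma walk_measure_eq_ball_mass:
  assumes "regular_graph G d" "z \<in> pverts G"
  shows "walk_measure G \<alpha> z = ball_mass G z ((1 - \<alpha>) / d) (\<alpha> - (1 - \<alpha>) / d)"
  using assms by (auto simp: fun_eq_iff walk_measure_def ball_mass_def closed_neighbors_def regular_graph_def)

lemma couplings_ball_mass_nonempty:
  assumes "regular_graph G d" "z1 \<in> pverts G" "z2 \<in> pverts G" "finite S"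
    "closed_neighbors G z1 \<union> closed_neighbors G z2 \<subseteq> S" "0 \<le> c" "0 \<le> c + e"
  shows "couplings S S (ball_mass G z1 c e) (ball_mass G z2 c e) \<noteq> {}"
proof (rule couplings_nonempty)
  show "sum (ball_mass G z1 c e) S = sum (ball_mass G z2 c e) S"
    using assms by (simp add: sum_ball_mass)
qed (use assms ball_mass_nonneg in auto)

text \<open>The vertices are adjacent, so the denominator of the curvature is 1. The edge also gives
  \<open>d \<ge> 1\<close>, which keeps all masses at most 1.\<close>

lemma ollivier_curvature_eq_mincost:
  assumes reg: "regular_graph G d" and arc: "(z1, z2) \<in> parcs G"
    and S: "finite S" "S \<subseteq> pverts G" "closed_neighbors G z1 \<union> closed_neighbors G z2 \<subseteq> S"
    and reach: "\<And>u w. u \<in> S \<Longrightarrow> w \<in> S \<Longrightarrow> (u, w) \<in> (parcs G)\<^sup>*"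
    and \<alpha>: "0 \<le> \<alpha>" "\<alpha> \<le> 1"
  defines "c \<equiv> (1 - \<alpha>) / d"
  shows "ollivier_curvature G \<alpha> z1 z2 =
    1 - mincost (\<lambda>u w. hops (parcs G) u w) S S (ball_mass G z1 c (\<alpha> - c)) (ball_mass G z2 c (\<alpha> - c))"
proof -
  have z: "z1 \<in> pverts G" "z2 \<in> pverts G" using arc in_arcsD1 in_arcsD2 by auto
  have ne: "z1 \<noteq> z2" using arc pair_no_loops by fastforce
  have "card (neighbors G z1) = d" using reg z by (simp add: regular_graph_def)
  moreover have "z2 \<in> neighbors G z1" using arc by (simp add: neighbors_def)
  ultimately have d: "d \<ge> 1" using locally_finite[OF z(1)] by (metis One_nat_def Suc_leI card_gt_0_iff empty_iff)
  have c: "0 \<le> c" "c \<le> 1"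
    using \<alpha> d unfolding c_def by (auto simp: field_simps intro: order_trans[of _ 1])
  have dist: "graph_dist G u w = ereal (hops (parcs G) u w)" if "u \<in> S" "w \<in> S" for u w
    using that S reach by (intro graph_dist_eq_hops) auto
  have "wasserstein G (ball_mass G z1 c (\<alpha> - c)) (ball_mass G z2 c (\<alpha> - c)) =
    ereal (mincost (\<lambda>u w. hops (parcs G) u w) S S (ball_mass G z1 c (\<alpha> - c)) (ball_mass G z2 c (\<alpha> - c)))"
  proof (rule wasserstein_eq_mincost[OF S(1,2)])
    show "couplings S S (ball_mass G z1 c (\<alpha> - c)) (ball_mass G z2 c (\<alpha> - c)) \<noteq> {}"
      using \<alpha> c by (intro couplings_ball_mass_nonempty[OF reg z S(1,3)]) auto
    show "ball_mass G z1 c (\<alpha> - c) u \<le> 1" for u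
      using \<alpha> c by (auto simp: ball_mass_def closed_neighbors_def)
  qed (use dist S in \<open>auto simp: ball_mass_def closed_neighbors_def\<close>)
  moreover have "graph_dist G z1 z2 = 1"
    using dist[of z1 z2] S(3) hops_arc[OF arc ne] by (auto simp: closed_neighbors_def one_ereal_def)
  ultimately show ?thesis
    unfolding ollivier_curvature_def walk_measure_eq_ball_mass[OF reg z(1)]
      walk_measure_eq_ball_mass[OF reg z(2)]
    by (simp flip: c_def add: one_ereal_def divide_ereal_def)
qed

end

section \<open>Transport across an edge of a regular graph\<close>

text \<open>The form of what is left after removal of the common mass: private neighbours
  \<open>P\<close> and one spike. The spike sits at \<open>y1\<close> or \<open>y2\<close>,
  depending on the sign of the surplus.\<close>

definition spiked_mass :: "'a set \<Rightarrow> 'a \<Rightarrow> real \<Rightarrow> real \<Rightarrow> 'a \<Rightarrow> real" where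
  "spiked_mass P a c h u = (if u \<in> P then c else 0) + (if u = a then h else 0)"

lemma sum_spiked_mass:
  "finite T \<Longrightarrow> P \<subseteq> T \<Longrightarrow> a \<in> T \<Longrightarrow> sum (spiked_mass P a c h) T = real (card P) * c + h"
  by (simp add: spiked_mass_def[abs_def] sum.distrib sum.If_cases Int_absorb1)

lemma spiked_mass_nonneg: "0 \<le> c \<Longrightarrow> 0 \<le> h \<Longrightarrow> 0 \<le> spiked_mass P a c h u"
  by (simp add: spiked_mass_def)

abbreviation hop_cost :: "'a pair_pre_digraph \<Rightarrow> 'a \<Rightarrow> 'a \<Rightarrow> real" where
  "hop_cost G u w \<equiv> real (hops (parcs G) u w)"

locale regular_edge = locally_finite_graph G for G :: "'a pair_pre_digraph" +
  fixes d :: nat and y1 y2 :: 'a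
  assumes regular: "regular_graph G d" and arc: "(y1, y2) \<in> parcs G"
begin

definition "S = closed_neighbors G y1 \<union> closed_neighbors G y2"
definition "P1 = closed_neighbors G y1 - closed_neighbors G y2"
definition "P2 = closed_neighbors G y2 - closed_neighbors G y1"
definition "F0 = mincost (hop_cost G) P1 P2 (\<lambda>_. 1) (\<lambda>_. 1)"
text \<open>The crossed places of \<open>y2\<close> and \<open>y1\<close> reflect
  \<open>e = - c\<close>: then the measure around \<open>y1\<close> has mass \<open>c\<close> at
  \<open>y2\<close> and none at \<open>y1\<close>, and conversely.\<close>

definition "F1 = mincost (hop_cost G) (insert y2 P1) (insert y1 P2) (\<lambda>_. 1) (\<lambda>_. 1)"
definition "V c e = mincost (hop_cost G) S S (ball_mass G y1 c e) (ball_mass G y2 c e)"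

lemma verts: "y1 \<in> pverts G" "y2 \<in> pverts G"
  using arc in_arcsD1 in_arcsD2 by auto

lemma y1_neq_y2: "y1 \<noteq> y2"
  using arc pair_no_loops by fastforce

lemma finite_S: "finite S" and S_verts: "S \<subseteq> pverts G"
  using verts finite_closed_neighbors closed_neighbors_verts by (auto simp: S_def)

lemma common: "y1 \<in> closed_neighbors G y1" "y1 \<in> closed_neighbors G y2"
    "y2 \<in> closed_neighbors G y1" "y2 \<in> closed_neighbors G y2"
  using arc arc_sym by (auto simp: closed_neighbors_def neighbors_def)

lemma in_S: "y1 \<in> S" "y2 \<in> S" "P1 \<subseteq> S" "P2 \<subseteq> S"
  using common by (auto simp: S_def P1_def P2_def)

lemma notin_P: "y1 \<notin> P1" "y1 \<notin> P2" "y2 \<notin> P1" "y2 \<notin> P2"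
  using common by (auto simp: P1_def P2_def)

lemma finite_P: "finite P1" "finite P2"
  using in_S finite_S finite_subset by auto

lemma card_P: "card P1 = card P2"
proof -
  let ?N1 = "closed_neighbors G y1" and ?N2 = "closed_neighbors G y2"
  have "finite ?N1" "finite ?N2" "card ?N1 = card ?N2"
    using verts finite_closed_neighbors card_closed_neighbors[OF regular] by auto
  then show ?thesis
    using card_Int_Diff[of ?N1 ?N2] card_Int_Diff[of ?N2 ?N1] by (simp add: P1_def P2_def Int_commute)
qed

lemma degree_pos: "1 \<le> d"
proof -
  have "y2 \<in> neighbors G y1" using arc by (simp add: neighbors_def)
  moreover have "card (neighbors G y1) = d" using regular verts by (simp add: regular_graph_def)
  ultimately show ?thesis
    using locally_finite[OF verts(1)] by (metis One_nat_def Suc_leI card_gt_0_iff empty_iff)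
qed

lemma reach: "u \<in> S \<Longrightarrow> w \<in> S \<Longrightarrow> (u, w) \<in> (parcs G)\<^sup>*"
  using ball_reachable[OF arc] by (simp add: S_def)

lemma hop_triangle:
  "\<forall>u\<in>S. \<forall>v\<in>S. \<forall>w\<in>S. hop_cost G u w \<le> hop_cost G u v + hop_cost G v w"
  using hops_triangle reach by (metis of_nat_add of_nat_mono)

lemma couplings_spiked_mass_nonempty:
  assumes "a \<in> S" "b \<in> S" "0 \<le> c" "0 \<le> h"
  shows "couplings S S (spiked_mass P1 a c h) (spiked_mass P2 b c h) \<noteq> {}"
  using assms finite_S in_S card_P
  by (intro couplings_nonempty) (auto simp: sum_spiked_mass spiked_mass_nonneg)

lemma V_eq_residual:
  assumes ab: "a \<in> S" "b \<in> S" and nn: "0 \<le> c" "0 \<le> h" "\<And>u. 0 \<le> k u"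
    and k: "\<And>u. ball_mass G y1 c e u = k u + spiked_mass P1 a c h u"
      "\<And>u. ball_mass G y2 c e u = k u + spiked_mass P2 b c h u"
  shows "V c e = mincost (hop_cost G) S S (spiked_mass P1 a c h) (spiked_mass P2 b c h)"
proof -
  have "V c e = mincost (hop_cost G) S S (\<lambda>u. k u + spiked_mass P1 a c h u) (\<lambda>u. k u + spiked_mass P2 b c h u)"
    unfolding V_def by (intro mincost_cong) (auto simp: k)
  also have "\<dots> = mincost (hop_cost G) S S (spiked_mass P1 a c h) (spiked_mass P2 b c h)"
    using finite_S nn hop_triangle couplings_spiked_mass_nonempty[OF ab nn(1,2)]
    by (intro mincost_add_diagonal) (auto simp: spiked_mass_nonneg)
  finally show ?thesis .
qed

lemma ball_mass_split_pos:
  fixes c e :: real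
  defines "k \<equiv> \<lambda>u. if u \<in> closed_neighbors G y1 \<inter> closed_neighbors G y2 then c else 0"
  shows "ball_mass G y1 c e u = k u + spiked_mass P1 y1 c e u"
    and "ball_mass G y2 c e u = k u + spiked_mass P2 y2 c e u"
  by (auto simp: ball_mass_def spiked_mass_def P1_def P2_def k_def)

text \<open>Used for \<open>- c \<le> e \<le> 0\<close>, when \<open>k\<close> is the pointwise
  minimum of the two measures, equal to \<open>c + e\<close> at both \<open>y1\<close> and
  \<open>y2\<close>. The first measure exceeds it at \<open>y2\<close> and the second at
  \<open>y1\<close>, so the spikes change places.\<close>

lemma ball_mass_split_neg:
  fixes c e :: real
  defines "k \<equiv> \<lambda>u. (if u \<in> closed_neighbors G y1 \<inter> closed_neighbors G y2 then c else 0)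
    + (if u = y1 then e else 0) + (if u = y2 then e else 0)"
  shows "ball_mass G y1 c e u = k u + spiked_mass P1 y2 c (- e) u"
    and "ball_mass G y2 c e u = k u + spiked_mass P2 y1 c (- e) u"
  by (auto simp: ball_mass_def spiked_mass_def P1_def P2_def k_def)

lemma V_pos_residual:
  assumes "0 \<le> c" "0 \<le> e"
  shows "V c e = mincost (hop_cost G) S S (spiked_mass P1 y1 c e) (spiked_mass P2 y2 c e)"
  by (rule V_eq_residual[OF _ _ _ _ _ ball_mass_split_pos]) (use assms in_S in auto)

lemma V_neg_residual:
  assumes "0 \<le> c + e" "e \<le> 0"
  shows "V c e = mincost (hop_cost G) S S (spiked_mass P1 y2 c (- e)) (spiked_mass P2 y1 c (- e))"
  by (rule V_eq_residual[OF _ _ _ _ _ ball_mass_split_neg]) (use assms in_S common y1_neq_y2 in auto)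

lemma mincost_spiked_mass:
  assumes ab: "a \<in> S" "b \<in> S" "a \<notin> P1" "b \<notin> P2" and nn: "0 \<le> c" "0 \<le> h"
  shows "mincost (hop_cost G) S S (spiked_mass P1 a c h) (spiked_mass P2 b c h) =
    mincost (hop_cost G) (insert a P1) (insert b P2) ((\<lambda>_. c)(a := h)) ((\<lambda>_. c)(b := h))"
proof -
  have "couplings (insert a P1) (insert b P2) (spiked_mass P1 a c h) (spiked_mass P2 b c h) \<noteq> {}"
  proof (rule couplings_nonempty)
    show "sum (spiked_mass P1 a c h) (insert a P1) = sum (spiked_mass P2 b c h) (insert b P2)"
      using finite_P card_P by (simp add: sum_spiked_mass subset_insertI)
  qed (use finite_P nn in \<open>auto simp: spiked_mass_def\<close>)
  then have "mincost (hop_cost G) S S (spiked_mass P1 a c h) (spiked_mass P2 b c h) =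
    mincost (hop_cost G) (insert a P1) (insert b P2) (spiked_mass P1 a c h) (spiked_mass P2 b c h)"
    using finite_S ab in_S by (intro mincost_restrict) (auto simp: spiked_mass_def)
  also have "\<dots> = mincost (hop_cost G) (insert a P1) (insert b P2) ((\<lambda>_. c)(a := h)) ((\<lambda>_. c)(b := h))"
    using ab by (intro mincost_cong) (auto simp: spiked_mass_def)
  finally show ?thesis .
qed

lemma couplings_P_nonempty: "couplings P1 P2 (\<lambda>_. 1) (\<lambda>_. 1) \<noteq> {}"
  using finite_P card_P by (intro couplings_nonempty) auto

text \<open>
  For \<open>u \<in> P1\<close> and \<open>w \<in> P2\<close> the detour over the edge gives \<open>d(u, w) \<le> 3\<close>, whereas
  \<open>d(y1, w)\<close> and \<open>d(u, y2)\<close> are at least \<open>2\<close>; hence the surplus mass may go from \<open>y1\<close> straight to \<open>y2\<close>.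
\<close>

lemma V_pos:
  assumes "0 \<le> c" "0 \<le> e"
  shows "V c e = e + c * F0"
proof -
  have c12: "hop_cost G y1 y2 = 1" using hops_arc[OF arc y1_neq_y2] by simp
  have swap: "hop_cost G u w + hop_cost G y1 y2 \<le> hop_cost G y1 w + hop_cost G u y2"
    if "u \<in> P1" "w \<in> P2" for u w
  proof -
    have S: "u \<in> S" "w \<in> S" using that in_S by auto
    have ne: "u \<noteq> y1" "u \<noteq> y2" "w \<noteq> y1" "w \<noteq> y2" using that notin_P by auto
    have "(u, y1) \<in> parcs G" "(y2, w) \<in> parcs G" "(y1, w) \<notin> parcs G" "(u, y2) \<notin> parcs G"
      using that ne arc_sym by (auto simp: P1_def P2_def closed_neighbors_def neighbors_def)
    then have "hops (parcs G) u y1 = 1" "hops (parcs G) y2 w = 1"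
      "2 \<le> hops (parcs G) y1 w" "2 \<le> hops (parcs G) u y2"
      using ne S in_S hops_arc[of u y1 "parcs G"] hops_arc[of y2 w "parcs G"]
      by (auto intro!: hops_ge_2 reach)
    \<comment> \<open>The first inequality reads \<open>d(u, w) \<le> 1 + d(y1, w)\<close>; adding
      the edge gives \<open>d(y1, w) + 2\<close>, and \<open>2 \<le> d(u, y2)\<close>.\<close>
    moreover have "hop_cost G u w \<le> hop_cost G u y1 + hop_cost G y1 w"
      "hop_cost G y1 w \<le> hop_cost G y1 y2 + hop_cost G y2 w"
      using hop_triangle S in_S by blast+
    ultimately show ?thesis using c12 by simp
  qed
  have ne: "couplings P1 P2 (\<lambda>_. c) (\<lambda>_. c) \<noteq> {}"
    using finite_P card_P assms by (intro couplings_nonempty) auto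
  have "V c e = mincost (hop_cost G) (insert y1 P1) (insert y2 P2) ((\<lambda>_. c)(y1 := e)) ((\<lambda>_. c)(y2 := e))"
    using assms in_S notin_P by (simp add: V_pos_residual mincost_spiked_mass)
  also have "\<dots> = e * hop_cost G y1 y2 + mincost (hop_cost G) P1 P2 (\<lambda>_. c) (\<lambda>_. c)"
    using finite_P notin_P assms ne swap by (intro mincost_transfer) auto
  also have "mincost (hop_cost G) P1 P2 (\<lambda>_. c) (\<lambda>_. c) = c * F0"
    using mincost_scale[of P1 P2 c "hop_cost G" "\<lambda>_. 1" "\<lambda>_. 1"] finite_P assms couplings_P_nonempty
    by (simp add: F0_def)
  finally show ?thesis by (simp add: c12)
qed

text \<open>Division by \<open>c\<close> turns the private masses into 1 and the spike into
  \<open>g = - e / c\<close>, a number in the unit interval, so that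
  \<open>mincost_interpolate\<close> applies.\<close>

lemma V_neg:
  assumes "0 < c" "0 \<le> c + e" "e \<le> 0"
  shows "V c e = (c + e) * F0 - e * F1"
proof -
  define g where "g = - e / c"
  have g: "0 \<le> g" "g \<le> 1" "c * g = - e" using assms by (auto simp: g_def field_simps)
  let ?m = "\<lambda>g. mincost (hop_cost G) (insert y2 P1) (insert y1 P2) ((\<lambda>_. 1)(y2 := g)) ((\<lambda>_. 1)(y1 := g))"
  have "V c e = mincost (hop_cost G) (insert y2 P1) (insert y1 P2) ((\<lambda>_. c)(y2 := - e)) ((\<lambda>_. c)(y1 := - e))"
    using assms in_S notin_P by (simp add: V_neg_residual mincost_spiked_mass)
  also have "\<dots> = mincost (hop_cost G) (insert y2 P1) (insert y1 P2)
      (\<lambda>u. c * ((\<lambda>_. 1)(y2 := g)) u) (\<lambda>w. c * ((\<lambda>_. 1)(y1 := g)) w)"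
    using g by (intro mincost_cong) auto
  also have "\<dots> = c * ?m g"
  proof (rule mincost_scale)
    show "couplings (insert y2 P1) (insert y1 P2) ((\<lambda>_. 1)(y2 := g)) ((\<lambda>_. 1)(y1 := g)) \<noteq> {}"
      using couplings_insert(1)[OF finite_P notin_P(3,2) g(1)] couplings_P_nonempty by blast
  qed (use finite_P assms in auto)
  also have "?m g = (1 - g) * F0 + g * ?m 1"
    unfolding F0_def using finite_P card_P notin_P g by (intro mincost_interpolate) auto
  also have "?m 1 = F1"
    unfolding F1_def by (intro mincost_cong) auto
  also have "c * ((1 - g) * F0 + g * F1) = (c - c * g) * F0 + (c * g) * F1"
    by (simp add: algebra_simps)
  finally show ?thesis by (simp add: g(3))
qed

lemma curvature_eq_V:
  "0 \<le> \<alpha> \<Longrightarrow> \<alpha> \<le> 1 \<Longrightarrow> ollivier_curvature G \<alpha> y1 y2 = 1 - V ((1 - \<alpha>) / d) (\<alpha> - (1 - \<alpha>) / d)"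
  unfolding V_def using finite_S S_verts reach
  by (intro ollivier_curvature_eq_mincost[OF regular arc]) (auto simp: S_def)

end

lemma Lim_at_left_1_eqI:
  fixes f :: "real \<Rightarrow> real"
  assumes "\<And>\<alpha>. 1 / 2 < \<alpha> \<Longrightarrow> \<alpha> < 1 \<Longrightarrow> f \<alpha> = L"
  shows "Lim (at_left 1) f = L"
proof (rule tendsto_Lim)
  have "\<forall>\<^sub>F \<alpha> in at_left 1. f \<alpha> = L"
    using assms eventually_at_left[of "1 / 2" "1 :: real"] by (auto intro!: exI[of _ "1 / 2"])
  then show "(f \<longlongrightarrow> L) (at_left 1)" by (rule tendsto_eventually)
qed simp

section \<open>Transport in the strong product\<close>

text \<open>The push-forward of a plan: entries are summed over both fibres, and each unit of mass
  is charged no more than before.\<close>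

lemma mincost_project:
  fixes C :: "'b \<Rightarrow> 'b \<Rightarrow> real" and C' :: "'a \<times> 'b \<Rightarrow> 'a \<times> 'b \<Rightarrow> real"
  assumes fin: "finite X" "finite S" and C: "\<forall>u\<in>S. \<forall>w\<in>S. 0 \<le> C u w"
    and le: "\<And>g u h w. g \<in> X \<Longrightarrow> u \<in> S \<Longrightarrow> h \<in> X \<Longrightarrow> w \<in> S \<Longrightarrow> C u w \<le> C' (g, u) (h, w)"
    and ne: "couplings (X \<times> S) (X \<times> S) s t \<noteq> {}"
  shows "mincost C S S (\<lambda>u. \<Sum>g\<in>X. s (g, u)) (\<lambda>w. \<Sum>h\<in>X. t (h, w)) \<le> mincost C' (X \<times> S) (X \<times> S) s t"
proof (rule mincost_mono[OF C ne])
  fix p assume p: "p \<in> couplings (X \<times> S) (X \<times> S) s t"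
  note pD = couplingsD[OF p]
  define q where "q u w = (\<Sum>g\<in>X. \<Sum>h\<in>X. p (g, u) (h, w))" for u w
  show "\<exists>q\<in>couplings S S (\<lambda>u. \<Sum>g\<in>X. s (g, u)) (\<lambda>w. \<Sum>h\<in>X. t (h, w)). cost C S S q \<le> cost C' (X \<times> S) (X \<times> S) p"
  proof (rule bexI)
    show "q \<in> couplings S S (\<lambda>u. \<Sum>g\<in>X. s (g, u)) (\<lambda>w. \<Sum>h\<in>X. t (h, w))"
    proof (rule couplingsI)
      show "0 \<le> q u w" if "u \<in> S" "w \<in> S" for u w
        using that pD(1) by (auto simp: q_def intro!: sum_nonneg)
      show "(\<Sum>w\<in>S. q u w) = (\<Sum>g\<in>X. s (g, u))" if u: "u \<in> S" for u
      proof -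
        have "(\<Sum>w\<in>S. q u w) = (\<Sum>g\<in>X. \<Sum>h\<in>X. \<Sum>w\<in>S. p (g, u) (h, w))"
          unfolding q_def by (subst sum.swap, intro sum.cong refl, rule sum.swap)
        also have "\<dots> = (\<Sum>g\<in>X. \<Sum>z\<in>X \<times> S. p (g, u) z)"
          by (simp add: sum.cartesian_product')
        also have "\<dots> = (\<Sum>g\<in>X. s (g, u))"
          using u pD(2) by (intro sum.cong) auto
        finally show ?thesis .
      qed
      show "(\<Sum>u\<in>S. q u w) = (\<Sum>h\<in>X. t (h, w))" if w: "w \<in> S" for w
      proof -
        have "(\<Sum>u\<in>S. q u w) = (\<Sum>u\<in>S. \<Sum>h\<in>X. \<Sum>g\<in>X. p (g, u) (h, w))"
          unfolding q_def by (rule sum.cong[OF refl], rule sum.swap)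
        also have "\<dots> = (\<Sum>h\<in>X. \<Sum>u\<in>S. \<Sum>g\<in>X. p (g, u) (h, w))"
          by (rule sum.swap)
        also have "\<dots> = (\<Sum>h\<in>X. \<Sum>g\<in>X. \<Sum>u\<in>S. p (g, u) (h, w))"
          by (intro sum.cong refl, rule sum.swap)
        also have "\<dots> = (\<Sum>h\<in>X. \<Sum>z\<in>X \<times> S. p z (h, w))"
          by (simp add: sum.cartesian_product')
        also have "\<dots> = (\<Sum>h\<in>X. t (h, w))"
          using w pD(3) by (intro sum.cong) auto
        finally show ?thesis .
      qed
    qed
    have "cost C S S q = (\<Sum>u\<in>S. \<Sum>w\<in>S. \<Sum>g\<in>X. \<Sum>h\<in>X. C u w * p (g, u) (h, w))"
      by (simp add: cost_def q_def sum_distrib_left)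
    also have "\<dots> \<le> (\<Sum>u\<in>S. \<Sum>w\<in>S. \<Sum>g\<in>X. \<Sum>h\<in>X. C' (g, u) (h, w) * p (g, u) (h, w))"
      using le pD(1) by (intro sum_mono mult_right_mono) auto
    also have "\<dots> = (\<Sum>u\<in>S. \<Sum>g\<in>X. \<Sum>h\<in>X. \<Sum>w\<in>S. C' (g, u) (h, w) * p (g, u) (h, w))"
      by (intro sum.cong refl, subst sum.swap, intro sum.cong refl, rule sum.swap)
    also have "\<dots> = (\<Sum>g\<in>X. \<Sum>u\<in>S. \<Sum>h\<in>X. \<Sum>w\<in>S. C' (g, u) (h, w) * p (g, u) (h, w))"
      by (rule sum.swap)
    also have "\<dots> = cost C' (X \<times> S) (X \<times> S) p"
      by (simp add: cost_def sum.cartesian_product')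
    finally show "cost C S S q \<le> cost C' (X \<times> S) (X \<times> S) p" .
  qed
qed

text \<open>
  The kernel \<open>K\<close> keeps the mass in its fibre, except that the mass at \<open>a\<close> sits in the fibre
  over \<open>xa\<close> only and the mass at \<open>b\<close> over \<open>xb\<close> only.
\<close>

lemma mincost_lift:
  fixes C :: "'b \<Rightarrow> 'b \<Rightarrow> real" and C' :: "'a \<times> 'b \<Rightarrow> 'a \<times> 'b \<Rightarrow> real"
    and c h :: real
  assumes fin: "finite X" "finite S" and X: "xa \<in> X" "xb \<in> X"
    and C': "\<forall>u\<in>X \<times> S. \<forall>w\<in>X \<times> S. 0 \<le> C' u w"
    and ab: "a \<in> S" "b \<in> S" "a \<notin> P" "b \<notin> Q" "P \<subseteq> S" "Q \<subseteq> S"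
    and le: "\<And>g u w. g \<in> X \<Longrightarrow> u \<in> P \<Longrightarrow> w \<in> Q \<Longrightarrow> C' (g, u) (g, w) \<le> C u w"
      "\<And>h w. h \<in> X \<Longrightarrow> w \<in> insert b Q \<Longrightarrow> C' (xa, a) (h, w) \<le> C a w"
      "\<And>g u. g \<in> X \<Longrightarrow> u \<in> insert a P \<Longrightarrow> C' (g, u) (xb, b) \<le> C u b"
    and ne: "couplings S S (spiked_mass P a (card X * c) h) (spiked_mass Q b (card X * c) h) \<noteq> {}"
  shows "mincost C' (X \<times> S) (X \<times> S) (spiked_mass (X \<times> P) (xa, a) c h) (spiked_mass (X \<times> Q) (xb, b) c h)
    \<le> mincost C S S (spiked_mass P a (card X * c) h) (spiked_mass Q b (card X * c) h)"
proof (rule mincost_mono[OF C' ne])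
  define n where "n = real (card X)"
  have "card X > 0" using fin X card_gt_0_iff by blast
  then have n: "n > 0" by (simp add: n_def)
  fix q assume q: "q \<in> couplings S S (spiked_mass P a (card X * c) h) (spiked_mass Q b (card X * c) h)"
  note qD = couplingsD[OF q]
  have q0: "q u w = 0" if "u \<in> S" "w \<in> S" "u \<notin> insert a P \<or> w \<notin> insert b Q" for u w
    using couplings_eq_0[OF fin(2) fin(2) q that(1,2)] that(3) by (auto simp: spiked_mass_def)
  \<comment> \<open>For mass moving from \<open>u\<close> to \<open>w\<close>,
    \<open>K u w g h\<close> is the share that goes from fibre \<open>g\<close> to fibre
    \<open>h\<close>.\<close>
  define K :: "'b \<Rightarrow> 'b \<Rightarrow> 'a \<Rightarrow> 'a \<Rightarrow> real" where
    "K u w g h = (if u = a then (if g = xa then if w = b then if h = xb then 1 else 0 else 1 / n else 0)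
      else if w = b then (if h = xb then 1 / n else 0) else if g = h then 1 / n else 0)" for u w g h
  have K0: "0 \<le> K u w g h" for u w g h using n by (simp add: K_def)
  \<comment> \<open>The row sums depend on \<open>u\<close> and \<open>g\<close> only, the column
    sums on \<open>w\<close> and \<open>h\<close> only. Hence the marginals of \<open>p\<close> are
    those of \<open>q\<close> split over the fibres: \<open>n * c\<close> into \<open>n\<close>
    equal parts, the spike undivided.\<close>
  have Krow: "(\<Sum>h\<in>X. K u w g h) = (if u = a then if g = xa then 1 else 0 else 1 / n)" if "g \<in> X" for u w g
    using that fin X n by (cases "u = a"; cases "w = b") (auto simp: K_def n_def)
  have Kcol: "(\<Sum>g\<in>X. K u w g h) = (if w = b then if h = xb then 1 else 0 else 1 / n)" if "h \<in> X" for u w h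
    using that fin X n by (cases "u = a"; cases "w = b") (auto simp: K_def n_def)
  have Ksum: "(\<Sum>g\<in>X. \<Sum>h\<in>X. K u w g h) = 1" for u w
    using fin X n by (cases "u = a") (simp_all add: Krow, simp add: n_def)
  define p where "p x y = q (snd x) (snd y) * K (snd x) (snd y) (fst x) (fst y)" for x y
  show "\<exists>p\<in>couplings (X \<times> S) (X \<times> S) (spiked_mass (X \<times> P) (xa, a) c h) (spiked_mass (X \<times> Q) (xb, b) c h).
    cost C' (X \<times> S) (X \<times> S) p \<le> cost C S S q"
  proof (rule bexI)
    show "p \<in> couplings (X \<times> S) (X \<times> S) (spiked_mass (X \<times> P) (xa, a) c h) (spiked_mass (X \<times> Q) (xb, b) c h)"
    proof (rule couplingsI)
      show "0 \<le> p x y" if "x \<in> X \<times> S" "y \<in> X \<times> S" for x y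
        using that qD(1) K0 by (auto simp: p_def)
    next
      fix x assume "x \<in> X \<times> S"
      then obtain g u where x: "x = (g, u)" "g \<in> X" "u \<in> S" by auto
      have "(\<Sum>y\<in>X \<times> S. p x y) = (\<Sum>w\<in>S. \<Sum>h\<in>X. q u w * K u w g h)"
        by (simp add: sum.cartesian_product' p_def x sum.swap[of _ S X])
      also have "\<dots> = (\<Sum>w\<in>S. q u w) * (if u = a then if g = xa then 1 else 0 else 1 / n)"
        by (simp only: Krow[OF x(2)] flip: sum_distrib_left sum_distrib_right)
      also have "\<dots> = spiked_mass (X \<times> P) (xa, a) c h x"
        using x qD(2)[OF x(3)] ab n by (auto simp: spiked_mass_def n_def)
      finally show "(\<Sum>y\<in>X \<times> S. p x y) = spiked_mass (X \<times> P) (xa, a) c h x" .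
    next
      fix y assume "y \<in> X \<times> S"
      then obtain h' w where y: "y = (h', w)" "h' \<in> X" "w \<in> S" by auto
      have "(\<Sum>x\<in>X \<times> S. p x y) = (\<Sum>u\<in>S. \<Sum>g\<in>X. q u w * K u w g h')"
        by (simp add: sum.cartesian_product' p_def y sum.swap[of _ S X])
      also have "\<dots> = (\<Sum>u\<in>S. q u w) * (if w = b then if h' = xb then 1 else 0 else 1 / n)"
        by (simp only: Kcol[OF y(2)] flip: sum_distrib_left sum_distrib_right)
      also have "\<dots> = spiked_mass (X \<times> Q) (xb, b) c h y"
        using y qD(3)[OF y(3)] ab n by (auto simp: spiked_mass_def n_def)
      finally show "(\<Sum>x\<in>X \<times> S. p x y) = spiked_mass (X \<times> Q) (xb, b) c h y" .
    qed
    \<comment> \<open>The costs need comparing only where \<open>q\<close> and \<open>K\<close> are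
      both nonzero; those entries are exactly the ones covered by the three hypotheses
      \<open>le\<close>.\<close>
    have pw: "C' (g, u) (h, w) * (q u w * K u w g h) \<le> C u w * (q u w * K u w g h)"
      if "g \<in> X" "u \<in> S" "h \<in> X" "w \<in> S" for g u h w
    proof (cases "u \<in> insert a P \<and> w \<in> insert b Q \<and> K u w g h \<noteq> 0")
      case True
      then have "C' (g, u) (h, w) \<le> C u w"
        using le that by (auto simp: K_def split: if_splits)
      then show ?thesis using qD(1) K0 that by (intro mult_right_mono mult_nonneg_nonneg) auto
    next
      case False
      then have "q u w * K u w g h = 0" using q0 that by auto
      then show ?thesis by (simp only: mult_zero_right)
    qed
    have "cost C' (X \<times> S) (X \<times> S) p =
        (\<Sum>g\<in>X. \<Sum>u\<in>S. \<Sum>h\<in>X. \<Sum>w\<in>S. C' (g, u) (h, w) * (q u w * K u w g h))"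
      by (simp add: cost_def sum.cartesian_product' p_def)
    also have "\<dots> \<le> (\<Sum>g\<in>X. \<Sum>u\<in>S. \<Sum>h\<in>X. \<Sum>w\<in>S. C u w * (q u w * K u w g h))"
      using pw by (intro sum_mono) auto
    also have "\<dots> = (\<Sum>g\<in>X. \<Sum>u\<in>S. \<Sum>w\<in>S. \<Sum>h\<in>X. C u w * (q u w * K u w g h))"
      by (intro sum.cong refl, rule sum.swap)
    also have "\<dots> = (\<Sum>u\<in>S. \<Sum>w\<in>S. \<Sum>g\<in>X. \<Sum>h\<in>X. C u w * (q u w * K u w g h))"
      by (subst sum.swap, intro sum.cong refl, rule sum.swap)
    also have "\<dots> = (\<Sum>u\<in>S. \<Sum>w\<in>S. C u w * q u w * (\<Sum>g\<in>X. \<Sum>h\<in>X. K u w g h))"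
      by (simp only: sum_distrib_left mult.assoc)
    also have "\<dots> = cost C S S q"
      by (simp add: Ksum cost_def)
    finally show "cost C' (X \<times> S) (X \<times> S) p \<le> cost C S S q" .
  qed
qed

section \<open>Distances in the strong product\<close>

locale strong_product_graphs =
  G: locally_finite_graph G + H: locally_finite_graph H
  for G :: "'a pair_pre_digraph" and H :: "'b pair_pre_digraph"
begin

sublocale GH: locally_finite_graph "G \<boxtimes> H"
  using G.locally_finite_graph_axioms H.locally_finite_graph_axioms
  by (rule locally_finite_graph_strong_product)

lemma closed_neighbors_product:
  assumes "x \<in> pverts G" "y \<in> pverts H"
  shows "closed_neighbors (G \<boxtimes> H) (x, y) = closed_neighbors G x \<times> closed_neighbors H y"
  using neighbors_strong_product[OF G.locally_finite_graph_axioms H.locally_finite_graph_axioms assms]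
  by (auto simp: closed_neighbors_def)

lemma product_arcI:
  "\<lbrakk>g \<in> pverts G; u \<in> pverts H; h \<in> closed_neighbors G g; w \<in> closed_neighbors H u; (g, u) \<noteq> (h, w)\<rbrakk>
    \<Longrightarrow> ((g, u), (h, w)) \<in> parcs (G \<boxtimes> H)"
  using G.closed_neighbors_verts[of g] H.closed_neighbors_verts[of u]
  by (auto simp: strong_product_def)

text \<open>A step of the product may leave the second coordinate unchanged, so the projected walk
  can be shorter.\<close>

lemma relpow_product_snd:
  "(x, y) \<in> parcs (G \<boxtimes> H) ^^ k \<Longrightarrow> \<exists>j\<le>k. (snd x, snd y) \<in> parcs H ^^ j"
proof (induction k arbitrary: y)
  case (Suc k)
  then obtain z where z: "(x, z) \<in> parcs (G \<boxtimes> H) ^^ k" "(z, y) \<in> parcs (G \<boxtimes> H)"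
    by auto
  from Suc.IH[OF z(1)] obtain j where j: "j \<le> k" "(snd x, snd z) \<in> parcs H ^^ j" by blast
  have "snd z = snd y \<or> (snd z, snd y) \<in> parcs H"
    using z(2) by (auto simp: strong_product_def closed_neighbors_def neighbors_def)
  then show ?case
  proof
    assume "snd z = snd y"
    then show ?thesis using j by (intro exI[of _ j]) auto
  next
    assume "(snd z, snd y) \<in> parcs H"
    then show ?thesis using j by (intro exI[of _ "Suc j"]) auto
  qed
qed auto

lemma hops_le_hops_product:
  assumes "((g, u), (h, w)) \<in> (parcs (G \<boxtimes> H))\<^sup>*"
  shows "hops (parcs H) u w \<le> hops (parcs (G \<boxtimes> H)) (g, u) (h, w)"
  using relpow_product_snd[OF relpow_hops[OF assms]] hops_le by (fastforce intro: order_trans)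

lemma relpow_product_fibre:
  "\<lbrakk>(u, w) \<in> parcs H ^^ k; g \<in> pverts G\<rbrakk> \<Longrightarrow> ((g, u), (g, w)) \<in> parcs (G \<boxtimes> H) ^^ k"
proof (induction k arbitrary: w)
  case (Suc k)
  then obtain v where v: "(u, v) \<in> parcs H ^^ k" "(v, w) \<in> parcs H" by auto
  have "v \<noteq> w" using v H.pair_no_loops by fastforce
  then have "((g, v), (g, w)) \<in> parcs (G \<boxtimes> H)"
    using v Suc.prems H.in_arcsD1
    by (intro product_arcI) (auto simp: closed_neighbors_def neighbors_def)
  with Suc.IH[OF v(1)] Suc.prems show ?case by auto
qed simp

text \<open>The change of fibre is made together with the first step in \<open>H\<close>, so it costs nothing.\<close>

lemma relpow_product_cross:
  assumes "(u, w) \<in> parcs H ^^ Suc k" "g \<in> pverts G" "h \<in> closed_neighbors G g"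
  shows "((g, u), (h, w)) \<in> parcs (G \<boxtimes> H) ^^ Suc k"
proof -
  from assms(1) obtain v where v: "(u, v) \<in> parcs H" "(v, w) \<in> parcs H ^^ k"
    by (meson relpow_Suc_E2)
  have "u \<noteq> v" using v H.pair_no_loops by fastforce
  then have "((g, u), (h, v)) \<in> parcs (G \<boxtimes> H)"
    using v assms H.in_arcsD1
    by (intro product_arcI) (auto simp: closed_neighbors_def neighbors_def)
  moreover have "((h, v), (h, w)) \<in> parcs (G \<boxtimes> H) ^^ k"
    using v assms G.closed_neighbors_verts by (intro relpow_product_fibre) auto
  ultimately show ?thesis by (rule relpow_Suc_I2)
qed

text \<open>Changing the fibre is free only if there is a step in \<open>H\<close> to combine it
  with, hence the condition \<open>u \<noteq> w\<close> for \<open>h\<close> different from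
  \<open>g\<close>.\<close>

lemma hops_product_le:
  assumes r: "(u, w) \<in> (parcs H)\<^sup>*" and g: "g \<in> pverts G" "h = g \<or> u \<noteq> w \<and> h \<in> closed_neighbors G g"
  shows "hops (parcs (G \<boxtimes> H)) (g, u) (h, w) \<le> hops (parcs H) u w"
proof (cases "h = g")
  case True
  then show ?thesis using relpow_product_fibre[OF relpow_hops[OF r] g(1)] hops_le by auto
next
  case False
  then have "u \<noteq> w" "h \<in> closed_neighbors G g" using g by auto
  moreover obtain k where "hops (parcs H) u w = Suc k"
    using hops_pos[OF r] \<open>u \<noteq> w\<close> by (metis not0_implies_Suc not_one_le_zero)
  ultimately show ?thesis
    using hops_le[OF relpow_product_cross[of u w k g h]] relpow_hops[OF r] g(1) by simp
qed

end

section \<open>Comparison of the optimal costs in the product and in \<open>H\<close>\<close>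

locale strong_product_edge =
  strong_product_graphs G H + E: regular_edge H d_H y1 y2
  for G :: "'a pair_pre_digraph" and H :: "'b pair_pre_digraph" and d_H y1 y2 +
  fixes d_G :: nat and x1 x2 :: 'a
  assumes regular_G: "regular_graph G d_G"
    and x_verts: "x1 \<in> pverts G" "x2 \<in> pverts G"
    and twins: "closed_neighbors G x1 = closed_neighbors G x2"
begin

definition "X = closed_neighbors G x1"

lemma X: "finite X" "x1 \<in> X" "x2 \<in> X" "X \<subseteq> pverts G" "card X = d_G + 1"
  using G.finite_closed_neighbors G.closed_neighbors_verts G.card_closed_neighbors[OF regular_G]
    x_verts twins by (auto simp: X_def closed_neighbors_def)

lemma closed_neighbors_twins: "closed_neighbors G x1 = X" "closed_neighbors G x2 = X"
  using twins by (auto simp: X_def)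

text \<open>The product edge is an instance of the same locale, so \<open>V\<close> and its residual
  forms are available on both sides. The case \<open>x1 = x2\<close> is included, since
  \<open>y1 \<noteq> y2\<close> already separates the endpoints.\<close>

sublocale P: regular_edge "G \<boxtimes> H" "d_G + d_H + d_G * d_H" "(x1, y1)" "(x2, y2)"
proof
  show "regular_graph (G \<boxtimes> H) (d_G + d_H + d_G * d_H)"
    using G.locally_finite_graph_axioms H.locally_finite_graph_axioms regular_G E.regular
    by (rule regular_graph_strong_product)
  show "((x1, y1), (x2, y2)) \<in> parcs (G \<boxtimes> H)"
    using x_verts E.verts E.common E.y1_neq_y2 X(3) by (intro product_arcI) (auto simp: X_def)
qed

text \<open>The twin condition is essential: the two closed balls have the same first factor
  \<open>X\<close>, so their differences are again products with \<open>X\<close>.\<close>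

lemma product_sets: "P.S = X \<times> E.S" "P.P1 = X \<times> E.P1" "P.P2 = X \<times> E.P2"
  using x_verts E.verts twins
  by (auto simp: P.S_def P.P1_def P.P2_def E.S_def E.P1_def E.P2_def closed_neighbors_product X_def)

text \<open>Every fibre contributes \<open>c\<close>, but the spike lies in one fibre only. This is
  the source of the factor \<open>card X\<close> on \<open>c\<close> and of its absence on
  \<open>e\<close>.\<close>

lemma sum_ball_mass_fibres:
  fixes c e :: real
  assumes "x \<in> X" "y \<in> pverts H" "closed_neighbors G x = X"
  shows "(\<Sum>g\<in>X. ball_mass (G \<boxtimes> H) (x, y) c e (g, u)) = ball_mass H y (card X * c) e u"
proof -
  have "x \<in> pverts G" using assms X by auto
  then have "ball_mass (G \<boxtimes> H) (x, y) c e (g, u) =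
      (if u \<in> closed_neighbors H y then c else 0) + (if g = x then if u = y then e else 0 else 0)"
    if "g \<in> X" for g
    using assms that by (auto simp: ball_mass_def closed_neighbors_product)
  then show ?thesis using X assms by (simp add: sum.distrib ball_mass_def)
qed

lemma V_le_product_V:
  fixes c e :: real
  assumes "0 \<le> c" "0 \<le> c + e"
  shows "E.V (card X * c) e \<le> P.V c e"
proof -
  have "E.V (card X * c) e = mincost (hop_cost H) E.S E.S
      (\<lambda>u. \<Sum>g\<in>X. ball_mass (G \<boxtimes> H) (x1, y1) c e (g, u)) (\<lambda>u. \<Sum>g\<in>X. ball_mass (G \<boxtimes> H) (x2, y2) c e (g, u))"
    unfolding E.V_def using X(2,3) E.verts closed_neighbors_twins
    by (intro mincost_cong) (auto simp: sum_ball_mass_fibres)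
  also have "\<dots> \<le> mincost (hop_cost (G \<boxtimes> H)) (X \<times> E.S) (X \<times> E.S)
      (ball_mass (G \<boxtimes> H) (x1, y1) c e) (ball_mass (G \<boxtimes> H) (x2, y2) c e)"
  proof (rule mincost_project)
    show "couplings (X \<times> E.S) (X \<times> E.S) (ball_mass (G \<boxtimes> H) (x1, y1) c e) (ball_mass (G \<boxtimes> H) (x2, y2) c e) \<noteq> {}"
      using P.finite_S assms product_sets P.S_def
      by (intro GH.couplings_ball_mass_nonempty[OF P.regular P.verts]) auto
    show "hop_cost H u w \<le> hop_cost (G \<boxtimes> H) (g, u) (h, w)"
      if "g \<in> X" "u \<in> E.S" "h \<in> X" "w \<in> E.S" for g u h w
      using that by (simp add: hops_le_hops_product P.reach product_sets)
  qed (use X E.finite_S in auto)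
  also have "\<dots> = P.V c e" by (simp add: P.V_def product_sets)
  finally show ?thesis .
qed

text \<open>The residual masses are lifted instead of the full ball masses. There
  \<open>a \<noteq> b\<close>, \<open>a\<close> is not in \<open>P2\<close> and \<open>b\<close> is
  not in \<open>P1\<close>, so mass that changes its fibre always moves in \<open>H\<close> as
  well.\<close>

lemma product_V_le_V:
  fixes c e :: real
  assumes c: "0 \<le> c" "0 \<le> c + e"
  shows "P.V c e \<le> E.V (card X * c) e"
proof -
  have lift: "mincost (hop_cost (G \<boxtimes> H)) (X \<times> E.S) (X \<times> E.S)
      (spiked_mass (X \<times> E.P1) (xa, a) c h) (spiked_mass (X \<times> E.P2) (xb, b) c h)
    \<le> mincost (hop_cost H) E.S E.S (spiked_mass E.P1 a (card X * c) h) (spiked_mass E.P2 b (card X * c) h)"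
    if ab: "{a, b} = {y1, y2}" and x: "xa \<in> {x1, x2}" "xb \<in> {x1, x2}" and h: "0 \<le> h" for a b xa xb h
  proof (rule mincost_lift)
    have S: "a \<in> E.S" "b \<in> E.S" and P: "a \<notin> E.P1" "b \<notin> E.P2" "a \<notin> E.P2" "b \<notin> E.P1" and ne: "a \<noteq> b"
      using ab E.in_S E.notin_P E.y1_neq_y2 by (auto simp: doubleton_eq_iff)
    show "a \<in> E.S" "b \<in> E.S" "a \<notin> E.P1" "b \<notin> E.P2" by fact+
    show "couplings E.S E.S (spiked_mass E.P1 a (card X * c) h) (spiked_mass E.P2 b (card X * c) h) \<noteq> {}"
      using S c h by (intro E.couplings_spiked_mass_nonempty) auto
    have xX: "closed_neighbors G xa = X" "closed_neighbors G xb = X" "xa \<in> pverts G" "xb \<in> pverts G"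
      using x twins x_verts by (auto simp: X_def)
    show "hop_cost (G \<boxtimes> H) (g, u) (g, w) \<le> hop_cost H u w"
      if "g \<in> X" "u \<in> E.P1" "w \<in> E.P2" for g u w
      using that X(4) E.in_S by (intro of_nat_mono hops_product_le E.reach) auto
    show "hop_cost (G \<boxtimes> H) (xa, a) (h, w) \<le> hop_cost H a w" if "h \<in> X" "w \<in> insert b E.P2" for h w
      using that X(4) E.in_S S P ne xX by (intro of_nat_mono hops_product_le E.reach) auto
    show "hop_cost (G \<boxtimes> H) (g, u) (xb, b) \<le> hop_cost H u b" if "g \<in> X" "u \<in> insert a E.P1" for g u
      using that X(4) E.in_S S P ne xX G.closed_neighbors_sym[of g xb]
      by (intro of_nat_mono hops_product_le E.reach) auto
  qed (use X x E.finite_S E.in_S in auto)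
  show ?thesis
  proof (cases "0 \<le> e")
    case True
    then show ?thesis
      using lift[of y1 y2 x1 x2 e] c by (simp add: P.V_pos_residual E.V_pos_residual product_sets)
  next
    case False
    \<comment> \<open>The residual form for a negative surplus needs \<open>card X * c + e\<close>
      to be nonnegative in \<open>H\<close>; this follows from the product condition because
      \<open>card X\<close> is at least 1.\<close>
    have "c \<le> real (card X) * c" using c X(5) mult_right_mono[of 1 "real (card X)" c] by simp
    then have "0 \<le> real (card X) * c + e" using c by linarith
    then show ?thesis
      using lift[of y2 y1 x2 x1 "- e"] c False
      by (simp add: P.V_neg_residual E.V_neg_residual product_sets insert_commute)
  qed
qed

lemma product_V:
  fixes c e :: real
  assumes "0 \<le> c" "0 \<le> c + e"
  shows "P.V c e = E.V (real (d_G + 1) * c) e"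
  using assms V_le_product_V[of c e] product_V_le_V[of c e] X(5) by simp

end

theorem theorem2:
  fixes G :: "'a pair_pre_digraph" and H :: "'b pair_pre_digraph"
    and d_G d_H d_GH :: nat
    and x1 x2 :: 'a and y1 y2 :: 'b
  assumes "locally_finite_graph G" and "locally_finite_graph H"
    and "regular_graph G d_G" and "regular_graph H d_H"
    and "d_GH = d_G + d_H + d_G * d_H"
    and "x1 \<in> pverts G" and "x2 \<in> pverts G"
    and "closed_neighbors G x1 = closed_neighbors G x2"
    and "(y1, y2) \<in> parcs H"
  shows "LLY_curvature (G \<boxtimes> H) (x1, y1) (x2, y2) =
      real (d_H * (d_G + 1)) / real d_GH * LLY_curvature H y1 y2
    \<and> ollivier_curvature (G \<boxtimes> H) 0 (x1, y1) (x2, y2) =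
      real (d_G * d_H) / real d_GH * LLY_curvature H y1 y2
      + real d_H / real d_GH * ollivier_curvature H 0 y1 y2"
proof -
  interpret strong_product_edge G H d_H y1 y2 d_G x1 x2
    using assms by (intro strong_product_edge.intro strong_product_graphs.intro
      regular_edge.intro regular_edge_axioms.intro strong_product_edge_axioms.intro)
  define D n F0 F1 where "D = real d_GH" and "n = real d_G + 1" and "F0 = E.F0" and "F1 = E.F1"
  have d: "1 \<le> real d_H" using E.degree_pos by simp
  have "1 \<le> d_GH" using P.degree_pos by (simp only: assms(5))
  then have D: "1 \<le> D" by (simp add: D_def)
  \<comment> \<open>Sizes of closed balls multiply. This identity is what makes \<open>n\<close>
    factor out of the Lin-Lu-Yau curvature of the product.\<close>
  have Dn: "D + 1 = n * (d_H + 1)" by (simp add: D_def n_def assms(5) algebra_simps)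
  have n: "1 \<le> n" by (simp add: n_def)
  have curv_H: "ollivier_curvature H \<alpha> y1 y2 = 1 - E.V ((1 - \<alpha>) / d_H) (\<alpha> - (1 - \<alpha>) / d_H)"
    if "0 \<le> \<alpha>" "\<alpha> \<le> 1" for \<alpha>
    using E.curvature_eq_V[OF that] .
  have curv_P: "ollivier_curvature (G \<boxtimes> H) \<alpha> (x1, y1) (x2, y2) =
      1 - E.V (n * ((1 - \<alpha>) / D)) (\<alpha> - (1 - \<alpha>) / D)" if "0 \<le> \<alpha>" "\<alpha> \<le> 1" for \<alpha>
    using P.curvature_eq_V[OF that] product_V[of "(1 - \<alpha>) / D" "\<alpha> - (1 - \<alpha>) / D"] that D
    by (simp add: D_def n_def assms(5) algebra_simps)
  have idle: "0 \<le> \<alpha> - (1 - \<alpha>) / k" if "1 / 2 < \<alpha>" "\<alpha> < 1" "1 \<le> k" for \<alpha> k :: real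
  proof -
    have "(1 - \<alpha>) / k \<le> 1 - \<alpha>" using that by (simp add: divide_le_eq mult_le_cancel_left1)
    then show ?thesis using that by linarith
  qed
  have LLY_H: "LLY_curvature H y1 y2 = (d_H + 1 - F0) / d_H"
    unfolding LLY_curvature_def
  proof (rule Lim_at_left_1_eqI)
    fix \<alpha> :: real assume \<alpha>: "1 / 2 < \<alpha>" "\<alpha> < 1"
    have "E.V ((1 - \<alpha>) / d_H) (\<alpha> - (1 - \<alpha>) / d_H) = \<alpha> - (1 - \<alpha>) / d_H + (1 - \<alpha>) / d_H * F0"
      unfolding F0_def using idle[OF \<alpha> d] \<alpha> by (intro E.V_pos) auto
    then have "ollivier_curvature H \<alpha> y1 y2 = 1 - (\<alpha> - (1 - \<alpha>) / d_H + (1 - \<alpha>) / d_H * F0)"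
      using curv_H[of \<alpha>] \<alpha> by simp
    also have "\<dots> = (1 - \<alpha>) * ((d_H + 1 - F0) / d_H)" using d by (simp add: field_simps)
    finally show "ollivier_curvature H \<alpha> y1 y2 / (1 - \<alpha>) = (d_H + 1 - F0) / d_H"
      using \<alpha> by simp
  qed
  have LLY_P: "LLY_curvature (G \<boxtimes> H) (x1, y1) (x2, y2) = n * (d_H + 1 - F0) / D"
    unfolding LLY_curvature_def
  proof (rule Lim_at_left_1_eqI)
    fix \<alpha> :: real assume \<alpha>: "1 / 2 < \<alpha>" "\<alpha> < 1"
    define c where "c = (1 - \<alpha>) / D"
    have c: "1 - \<alpha> = D * c" "c > 0" using D \<alpha> by (auto simp: c_def)
    have "E.V (n * c) (\<alpha> - c) = \<alpha> - c + n * c * F0"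
      unfolding F0_def using idle[OF \<alpha> D] c n D by (intro E.V_pos) (auto simp flip: c_def)
    then have "ollivier_curvature (G \<boxtimes> H) \<alpha> (x1, y1) (x2, y2) = 1 - \<alpha> + c - n * c * F0"
      using curv_P[of \<alpha>] \<alpha> by (simp add: c_def)
    also have "\<dots> = c * (D + 1 - n * F0)" by (simp add: c(1) algebra_simps)
    also have "\<dots> = c * (n * (d_H + 1 - F0))" unfolding Dn by (simp add: algebra_simps)
    finally show "ollivier_curvature (G \<boxtimes> H) \<alpha> (x1, y1) (x2, y2) / (1 - \<alpha>) = n * (d_H + 1 - F0) / D"
      using c by simp
  qed
  \<comment> \<open>Here \<open>c + e = 0\<close>, the far end of the deficit interval, so the
    coefficient of \<open>F0\<close> vanishes.\<close>
  have "E.V (1 / d_H) (- (1 / d_H)) = (1 / d_H + - (1 / d_H)) * F0 - - (1 / d_H) * F1"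
    unfolding F0_def F1_def using d by (intro E.V_neg) auto
  then have k_H: "ollivier_curvature H 0 y1 y2 = 1 - F1 / d_H"
    using curv_H[of 0] by simp
  \<comment> \<open>The deficit is \<open>1 / D\<close> out of the mass \<open>n / D\<close>, which
    leaves the weight \<open>(n - 1) / D = d_G / D\<close> on \<open>F0\<close>.\<close>
  have "E.V (n * (1 / D)) (- (1 / D)) = (n * (1 / D) + - (1 / D)) * F0 - - (1 / D) * F1"
    unfolding F0_def F1_def using D n by (intro E.V_neg) (auto simp: divide_right_mono)
  then have k_P: "ollivier_curvature (G \<boxtimes> H) 0 (x1, y1) (x2, y2) = 1 - (d_G * F0 + F1) / D"
    using curv_P[of 0] by (simp add: n_def algebra_simps add_divide_distrib)
  have d0: "real d_H \<noteq> 0" "D \<noteq> 0" using d D by auto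
  show ?thesis
  proof
    show "LLY_curvature (G \<boxtimes> H) (x1, y1) (x2, y2) =
      real (d_H * (d_G + 1)) / real d_GH * LLY_curvature H y1 y2"
      unfolding LLY_P LLY_H using d0 by (simp add: n_def D_def field_simps)
    \<comment> \<open>Writing \<open>D = d_G * (d_H + 1) + d_H\<close> separates the numerators of
      the two curvatures of \<open>H\<close>.\<close>
    have split_d: "D - (d_G * F0 + F1) = d_G * (d_H + 1 - F0) + (d_H - F1)"
      by (simp add: D_def assms(5) algebra_simps)
    have "1 - (d_G * F0 + F1) / D = (D - (d_G * F0 + F1)) / D"
      using d0 by (simp add: diff_divide_distrib)
    also have "\<dots> = d_G * (d_H + 1 - F0) / D + (d_H - F1) / D"
      by (simp only: split_d add_divide_distrib)
    also have "d_G * (d_H + 1 - F0) / D = real (d_G * d_H) / D * ((d_H + 1 - F0) / d_H)"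
      using d0 by simp
    also have "(d_H - F1) / D = real d_H / D * (1 - F1 / d_H)"
      using d0 by (simp add: right_diff_distrib diff_divide_distrib)
    finally show "ollivier_curvature (G \<boxtimes> H) 0 (x1, y1) (x2, y2) =
      real (d_G * d_H) / real d_GH * LLY_curvature H y1 y2
      + real d_H / real d_GH * ollivier_curvature H 0 y1 y2"
      unfolding k_P LLY_H k_H by (simp only: D_def)
  qed
qed

end
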